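(* Let $S$ be a finite ordered set of $n$ keys, $\mu$ a workload, $\mathcal{M}$ an atomized model family and $B\ge 0$ an atom budget. Then: (1) every routed piecewise learned index $D$ for $(S,\mu)$ using at most $B$ local model atoms satisfies $\mathbb{E}_{q\sim\mu}[T_D(q)]=\Omega(\mathsf{RGap}_{\mathcal{M}}(S,\mu,B))$; (2) for every $\eta>0$ there is a routed piecewise learned index $D$ using at most $B$ local model atoms with $\mathbb{E}_{q\sim\mu}[T_D(q)]\le O(\mathsf{RGap}_{\mathcal{M}}(S,\mu,B)+1)+\eta$. The hidden constants are independent of $S$, $\mu$ and $B$. The atom budget counts only local predictor records; directory topology, directory keys, the sorted key array, and any stored tables mapping pre-repair transcripts to repair comparison programs are not counted in $B$, and no bound in terms of $B$ alone is asserted for the size of such a transcript-to-repair-program table.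
   Context: Let $S=\{x_1<\dots<x_n\}$ be a subset of a totally ordered universe $\mathcal U$, $\mathrm{rank}_S(q)=|\{x\in S:x\le q\}|$, and the predecessor of $q$ is $\max\{x\in S:x\le q\}$. A workload is a probability measure $\mu$ on $\mathcal U$; for an interval $I$, $\mu(I)$ is its mass and $\mu_I$ the conditional measure on $I$. Logarithms are base 2 and $0\log(1/0)=0$. For an ordered partition $\Pi=\{I_1,\dots,I_m\}$ of $\mathcal U$ into contiguous intervals, $p_j=\mu(I_j)$ and $H_\mu(\Pi)=\sum_j p_j\log(1/p_j)$. The rank diameter of an interval is $R_I=1+\max_{q,q'\in I}|\mathrm{rank}_S(q)-\mathrm{rank}_S(q')|$. An atomized model family $\mathcal M=(\mathcal M_a)_{a\ge0}$ is a monotone sequence ($\mathcal M_a\subseteq\mathcal M_{a+1}$) of sets of local rank predictors, where a predictor in $\mathcal M_a$ is encoded by at most $a$ constant-size records ("atoms") of $O(w)$ bits ($w=\Theta(\log n)$); evaluation may compute arbitrarily on the query and these records, but every stored coefficient, breakpoint, exception, or payload used is charged to an atom; $\mathcal M_0$ contains only the empty predictor, which certifies radius $R_I$ on an interval $I$. A routed piecewise learned index $D$ consists of: an ordered partition $\Pi=\{I_1,\dots,I_m\}$ of $\mathcal U$ into contiguous key intervals; an ordered binary directory tree whose leaves are $I_1,\dots,I_m$ in left-to-right order, a query being routed by comparisons from the root to its leaf; for each positive-mass leaf either the empty predictor (radius $R_{I_j}$) or a predictor $h_j\in\mathcal M_{a_j}$ with $|h_j(q)-\mathrm{rank}_S(q)|\le\Delta_j$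 for all $q\in I_j$; and an exact repair procedure returning the predecessor/rank by comparisons of $q$ with stored keys inside the certified window. Its atom count is $\sum_j a_j$. $T_D(q)$ is the number of routing comparisons plus repair comparisons plus $O(1)$ for predictor evaluation. For a leaf $I$ with predictor $h$, the pre-repair transcript $Y_{I,h}(q)$ is the finite information available before the first repair comparison: leaf identity, encoded predictor, the value $h(q)$, the certified rank window, and deterministic side information computed from charged atoms; it excludes outcomes of comparisons of $q$ with stored keys. $A_I(q)\in\{0,\dots,n\}$ denotes the exact answer. The conditional repair entropy is $\mathsf{Rep}_\mu(I,h,\Delta)=H(A_I(q)\mid Y_{I,h}(q))$ for $q\sim\mu_I$. The residual-entropy functional is $\mathsf{RGap}_{\mathcal M}(S,\mu,B)=\inf\{H_\mu(\Pi)+\sum_j p_j\mathsf{Rep}_\mu(I_j,h_j,\Delta_j)\}$, the infimum over ordered partitions $\Pi$, predictors $h_j\in\mathcal M_{a_j}$ with $\sum_j a_j\le B$, and certified radii $\Delta_j$ of $h_j$ on $I_j$. *)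

theory Defs
  imports "HOL-Probability.Information"
begin

text \<open>The universe is a type \<open>'u\<close> of class \<open>linorder\<close>; the key set is a finite \<open>S :: 'u set\<close>.\<close>

subsection \<open>Keys, intervals, workloads\<close>

definition key_rank :: "'u::linorder set \<Rightarrow> 'u \<Rightarrow> nat" where
  "key_rank S q = card {x \<in> S. x \<le> q}"

definition order_convex :: "'u::linorder set \<Rightarrow> bool" where
  "order_convex I \<longleftrightarrow> (\<forall>x\<in>I. \<forall>y\<in>I. {x..y} \<subseteq> I)"

definition ordered_partition :: "'u::linorder set list \<Rightarrow> bool" where
  "ordered_partition Is \<longleftrightarrow>
     (\<forall>I\<in>set Is. I \<noteq> {} \<and> order_convex I) \<and> \<Union>(set Is) = UNIV \<and>
     sorted_wrt (\<lambda>I J. \<forall>x\<in>I. \<forall>y\<in>J. x < y) Is"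

text \<open>The only requirement on the sigma-algebra is that intervals have a mass.\<close>

definition workload :: "'u::linorder measure \<Rightarrow> bool" where
  "workload \<mu> \<longleftrightarrow> prob_space \<mu> \<and> space \<mu> = UNIV \<and> (\<forall>I. order_convex I \<longrightarrow> I \<in> sets \<mu>)"

text \<open>The conditional measure on \<open>I\<close>, as a measure whose space is \<open>I\<close> itself.\<close>

definition cond_workload :: "'u measure \<Rightarrow> 'u set \<Rightarrow> 'u measure" where
  "cond_workload \<mu> I = uniform_measure (restrict_space \<mu> I) I"

definition partition_entropy :: "'u measure \<Rightarrow> 'u set list \<Rightarrow> real" where
  "partition_entropy \<mu> Is = (\<Sum>I\<leftarrow>Is. measure \<mu> I * log 2 (1 / measure \<mu> I))"

definition rank_diameter :: "'u::linorder set \<Rightarrow> 'u set \<Rightarrow> real" where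
  "rank_diameter S I =
     1 + Max {\<bar>real (key_rank S q) - real (key_rank S q')\<bar> | q q'. q \<in> I \<and> q' \<in> I}"


subsection \<open>Atomized model families\<close>

text \<open>An atom is a bit string, and a predictor is identified with its list of atoms.  A family
  fixes once and for all how a list of atoms is evaluated at a query: the predicted rank, further
  (possibly query dependent) side information, and the evaluation cost.  The empty list is the
  empty predictor; it has neither a predicted rank nor side information, so \<open>predict M []\<close> and
  \<open>side_info M []\<close> are never used.\<close>

type_synonym atom = "bool list"

record 'u model_family =
  models :: "nat \<Rightarrow> atom list set"
  predict :: "atom list \<Rightarrow> 'u \<Rightarrow> real"
  side_info :: "atom list \<Rightarrow> 'u \<Rightarrow> bool list"
  eval_cost :: "atom list \<Rightarrow> 'u \<Rightarrow> real"

text \<open>\<open>\<beta>\<close> is the constant in the atom size \<open>O(w)\<close>, where \<open>w = \<Theta>(log n)\<close> is taken to be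
  \<open>log 2 (n + 2)\<close> so as to be positive for every \<open>n\<close>; \<open>\<kappa>\<close> is the \<open>O(1)\<close> bound on the evaluation
  cost.\<close>

definition atomized_family ::
  "real \<Rightarrow> real \<Rightarrow> nat \<Rightarrow> 'u measure \<Rightarrow> 'u model_family \<Rightarrow> bool" where
  "atomized_family \<beta> \<kappa> n \<mu> M \<longleftrightarrow>
     models M 0 = {[]} \<and>
     (\<forall>a. models M a \<subseteq> models M (Suc a)) \<and>
     (\<forall>a. \<forall>h\<in>models M a.
        length h \<le> a \<and>
        (\<forall>r\<in>set h. real (length r) \<le> \<beta> * log 2 (real n + 2)) \<and>
        predict M h \<in> borel_measurable \<mu> \<and>
        side_info M h \<in> measurable \<mu> (count_space UNIV) \<and>
        (\<forall>q. 0 \<le> eval_cost M h q \<and> eval_cost M h q \<le> \<kappa>))"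

record 'u leaf =
  interval :: "'u set"
  atoms :: nat
  model :: "atom list"
  radius :: real

text \<open>The finiteness conditions say that the transcript of a query is finite information; for
  integer-valued predictions the first one follows from the radius bound.\<close>

definition certified :: "'u::linorder set \<Rightarrow> 'u model_family \<Rightarrow> 'u leaf \<Rightarrow> bool" where
  "certified S M l \<longleftrightarrow>
     (if model l = [] then radius l = rank_diameter S (interval l)
      else (\<forall>q\<in>interval l. \<bar>predict M (model l) q - real (key_rank S q)\<bar> \<le> radius l) \<and>
           finite (predict M (model l) ` interval l) \<and>
           finite (side_info M (model l) ` interval l))"

text \<open>A leaf without a predictor is a leaf with the empty predictor.  So requiring a certified
  predictor on the leaves of mass zero as well excludes nothing: the empty predictor is available
  there and free.\<close>

definition configuration :: "'u::linorder set \<Rightarrow> 'u model_family \<Rightarrow> 'u leaf list \<Rightarrow> bool" where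
  "configuration S M ls \<longleftrightarrow>
     ordered_partition (map interval ls) \<and>
     (\<forall>l\<in>set ls. model l \<in> models M (atoms l) \<and> certified S M l)"

definition atom_count :: "'u leaf list \<Rightarrow> nat" where
  "atom_count ls = (\<Sum>l\<leftarrow>ls. atoms l)"


subsection \<open>Transcripts and residual entropy\<close>

text \<open>The certified window is a set of ranks.  For the empty predictor it consists of the
  \<open>rank_diameter S (interval l)\<close> ranks between the extreme ranks on the leaf.\<close>

definition window :: "'u::linorder set \<Rightarrow> 'u model_family \<Rightarrow> 'u leaf \<Rightarrow> 'u \<Rightarrow> nat set" where
  "window S M l q =
     (if model l = [] then {Min (key_rank S ` interval l)..Max (key_rank S ` interval l)}
      else {r. r \<le> card S \<and> \<bar>predict M (model l) q - real r\<bar> \<le> radius l})"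

record 'u transcript =
  tr_leaf :: "'u set"
  tr_model :: "atom list"
  tr_value :: "real option"
  tr_window :: "nat set"
  tr_side :: "bool list"

definition transcript ::
  "'u::linorder set \<Rightarrow> 'u model_family \<Rightarrow> 'u leaf \<Rightarrow> 'u \<Rightarrow> 'u transcript" where
  "transcript S M l q =
     \<lparr>tr_leaf = interval l,
      tr_model = model l,
      tr_value = (if model l = [] then None else Some (predict M (model l) q)),
      tr_window = window S M l q,
      tr_side = (if model l = [] then [] else side_info M (model l) q)\<rparr>"

text \<open>The exact answer is represented by the rank, which determines the predecessor.\<close>

definition repair_entropy ::
  "'u::linorder set \<Rightarrow> 'u measure \<Rightarrow> 'u model_family \<Rightarrow> 'u leaf \<Rightarrow> real" where
  "repair_entropy S \<mu> M l =
     prob_space.conditional_entropy (cond_workload \<mu> (interval l)) 2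
       (count_space (key_rank S ` interval l)) (count_space (transcript S M l ` interval l))
       (key_rank S) (transcript S M l)"

text \<open>On a leaf of mass zero the conditional measure is meaningless, but the factor
  \<open>measure \<mu> (interval l)\<close> removes the term.\<close>

definition residual_cost ::
  "'u::linorder set \<Rightarrow> 'u measure \<Rightarrow> 'u model_family \<Rightarrow> 'u leaf list \<Rightarrow> real" where
  "residual_cost S \<mu> M ls =
     partition_entropy \<mu> (map interval ls) +
     (\<Sum>l\<leftarrow>ls. measure \<mu> (interval l) * repair_entropy S \<mu> M l)"

definition RGap ::
  "'u::linorder set \<Rightarrow> 'u measure \<Rightarrow> 'u model_family \<Rightarrow> nat \<Rightarrow> real" where
  "RGap S \<mu> M B = Inf {residual_cost S \<mu> M ls | ls. configuration S M ls \<and> atom_count ls \<le> B}"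


subsection \<open>Comparison trees and routed piecewise learned indexes\<close>

text \<open>A comparison of a query \<open>q\<close> with a key \<open>k\<close> is one of the tests \<open>q < k\<close> and \<open>q \<le> k\<close>.\<close>

datatype 'u comparison = Lt (key: 'u) | Le (key: 'u)

fun holds :: "'u::linorder comparison \<Rightarrow> 'u \<Rightarrow> bool" where
  "holds (Lt k) q \<longleftrightarrow> q < k"
| "holds (Le k) q \<longleftrightarrow> q \<le> k"

datatype ('u, 'l) cmp_tree =
  Tip 'l
| Cmp "'u comparison" "('u, 'l) cmp_tree" "('u, 'l) cmp_tree"

fun run :: "('u::linorder, 'l) cmp_tree \<Rightarrow> 'u \<Rightarrow> 'l" where
  "run (Tip l) q = l"
| "run (Cmp c s t) q = (if holds c q then run s q else run t q)"

fun comparisons :: "('u::linorder, 'l) cmp_tree \<Rightarrow> 'u \<Rightarrow> nat" where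
  "comparisons (Tip l) q = 0"
| "comparisons (Cmp c s t) q = Suc (if holds c q then comparisons s q else comparisons t q)"

fun leaves :: "('u, 'l) cmp_tree \<Rightarrow> 'l list" where
  "leaves (Tip l) = [l]"
| "leaves (Cmp c s t) = leaves s @ leaves t"

fun keys :: "('u, 'l) cmp_tree \<Rightarrow> 'u set" where
  "keys (Tip l) = {}"
| "keys (Cmp c s t) = insert (key c) (keys s \<union> keys t)"

text \<open>The repair component is the table assigning to a transcript the comparison program that
  computes the rank.\<close>

record 'u learned_index =
  directory :: "('u, 'u leaf) cmp_tree"
  repair :: "'u transcript \<Rightarrow> ('u, nat) cmp_tree"

definition index_transcript ::
  "'u::linorder set \<Rightarrow> 'u model_family \<Rightarrow> 'u learned_index \<Rightarrow> 'u \<Rightarrow> 'u transcript" where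
  "index_transcript S M D q = transcript S M (run (directory D) q) q"

definition routed_index ::
  "'u::linorder set \<Rightarrow> 'u model_family \<Rightarrow> 'u learned_index \<Rightarrow> bool" where
  "routed_index S M D \<longleftrightarrow>
     configuration S M (leaves (directory D)) \<and>
     (\<forall>q. q \<in> interval (run (directory D) q)) \<and>
     (\<forall>q. let y = index_transcript S M D q in
        keys (repair D y) \<subseteq> {x \<in> S. key_rank S x \<in> tr_window y} \<and>
        run (repair D y) q = key_rank S q)"

definition index_atoms :: "'u learned_index \<Rightarrow> nat" where
  "index_atoms D = atom_count (leaves (directory D))"

definition query_cost ::
  "'u::linorder set \<Rightarrow> 'u model_family \<Rightarrow> 'u learned_index \<Rightarrow> 'u \<Rightarrow> real" where
  "query_cost S M D q =
     real (comparisons (directory D) q) +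
     real (comparisons (repair D (index_transcript S M D q)) q) +
     eval_cost M (model (run (directory D) q)) q"

text \<open>The cost of a routed index is nonnegative, so its expectation exists in \<open>ennreal\<close>.\<close>

definition expected_cost ::
  "'u::linorder set \<Rightarrow> 'u measure \<Rightarrow> 'u model_family \<Rightarrow> 'u learned_index \<Rightarrow> ennreal" where
  "expected_cost S \<mu> M D = (\<integral>\<^sup>+ q. ennreal (query_cost S M D q) \<partial>\<mu>)"

end

theory Submission
  imports Defs
begin

text \<open>
  Both the residual entropy and the expected cost are sums over the cells of queries that share a
  leaf, a transcript and a rank. For the lower bound, the depths of the directory leaves and, for
  every transcript, those of the rank labels of the repair tree satisfy Kraft's inequality, so
  Gibbs' inequality bounds the expected depths by the entropies, with constant 1.

  For the upper bound, a tree splitting at weighted medians reaches an item of weight \<open>w\<close> out of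
  a total \<open>W\<close> within \<open>2 log (W / w) + 2\<close> comparisons; this gives the directory and, with weights
  taken from the cells, one repair tree per transcript. The obstacle is that a partition may cut the
  universe at a gap (such as an irrational cut of the rationals), which no comparison can realise.
  As there are only finitely many keys, every gap has a neighbourhood without keys; making it a leaf
  of its own with the empty predictor costs no atoms and no repair, and changes the directory
  depth of every query by a constant only.
\<close>

subsection \<open>Alphabetic trees and Kraft's inequality\<close>

text \<open>The directory is not balanced for the masses of the refined parts, which can be
  arbitrarily small compared with the leaves they come from. It is balanced for weights that are at
  least the mass of every original leaf meeting the part and that add up to some W \<le> 3: a leaf
  counts once for itself and at most once for each of the gaps on its two sides. A query from a leaf
  of mass p thus needs at most 2 log (W / p) + 2 \<le> 2 log (1 / p) + 6 directory comparisons;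
  repair adds 2 to twice its log ratio, and evaluation adds at most \<kappa>. This is the constant 8
  + \<kappa>. All estimates are made query by query on the cells of the original configuration, so
  the residual entropy of the refined configuration never has to be compared with that of the
  original. Since the infimum in \<open>RGap\<close> need not be attained, a configuration within
  \<eta> / 2 of it is taken; the factor 2 of the trees turns this into \<eta>.\<close>

lemma log_ratio_nonneg: "0 < c \<Longrightarrow> c \<le> t \<Longrightarrow> 0 \<le> log 2 (t / c :: real)"
  by simp

text \<open>At \<open>k = 0\<close> the default values \<open>1 / 0 = 0\<close> and
  \<open>log 2 0 = 0\<close> apply.\<close>

lemma log_inverse_nonneg: "0 \<le> k \<Longrightarrow> k \<le> 1 \<Longrightarrow> 0 \<le> log 2 (1 / k :: real)"
  by (cases "k = 0") (simp_all add: log_def[of 2 0] log_divide)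

text \<open>The bound 4 rounds the total weight 3 of a refinement up to a power of two, which costs
  2 in the logarithm.\<close>

lemma log_ratio_le:
  fixes p w W :: real
  assumes "0 < p" "p \<le> w" "w \<le> W" "W \<le> 4"
  shows "log 2 (W / w) \<le> 2 + log 2 (1 / p)"
proof -
  have "log 2 (W / w) \<le> log 2 (4 / p)"
    using assms by (intro log_mono frac_le divide_pos_pos) auto
  also have "\<dots> = 2 + log 2 (1 / p)"
    using assms(1) log_pow_cancel[of 2 2] by (simp add: log_divide)
  finally show ?thesis .
qed

text \<open>The median \<open>x\<close> is the entry at which the running sum first reaches half of
  the total. Either list beside it may be empty.\<close>

lemma median_split:
  fixes w :: "'a \<Rightarrow> real"
  assumes "\<And>x. x \<in> set xs \<Longrightarrow> 0 \<le> w x" "xs \<noteq> []"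
  obtains as x bs where "xs = as @ x # bs"
    "2 * (\<Sum>x\<leftarrow>as. w x) \<le> (\<Sum>x\<leftarrow>xs. w x)" "2 * (\<Sum>x\<leftarrow>bs. w x) \<le> (\<Sum>x\<leftarrow>xs. w x)"
proof -
  \<comment> \<open>Here \<open>as\<close> is the prefix already scanned, weighing at most half as
    an invariant. If the rest after the next entry still weighs more than half, the prefix extended
    by that entry weighs less than half, and the scan goes on.\<close>
  have "\<exists>us x bs. ys = us @ x # bs \<and> 2 * (\<Sum>x\<leftarrow>as @ us. w x) \<le> (\<Sum>x\<leftarrow>as @ ys. w x) \<and>
          2 * (\<Sum>x\<leftarrow>bs. w x) \<le> (\<Sum>x\<leftarrow>as @ ys. w x)"
    if "2 * (\<Sum>x\<leftarrow>as. w x) \<le> (\<Sum>x\<leftarrow>as @ ys. w x)" "ys \<noteq> []"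
      and "\<And>x. x \<in> set (as @ ys) \<Longrightarrow> 0 \<le> w x" for as ys
    using that
  proof (induction ys arbitrary: as)
    case (Cons y ys)
    show ?case
    proof (cases "2 * (\<Sum>x\<leftarrow>ys. w x) \<le> (\<Sum>x\<leftarrow>as @ y # ys. w x)")
      case True
      then show ?thesis
        using Cons.prems by (intro exI[of _ "[]"] exI[of _ y] exI[of _ ys]) simp
    next
      case False
      then have "ys \<noteq> []"
        using sum_list_nonneg[of "map w (as @ [y])"] Cons.prems(3) by fastforce
      moreover have "2 * (\<Sum>x\<leftarrow>as @ [y]. w x) \<le> (\<Sum>x\<leftarrow>(as @ [y]) @ ys. w x)"
        using False by simp
      moreover have "0 \<le> w z" if "z \<in> set ((as @ [y]) @ ys)" for z
        using that Cons.prems(3) by simp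
      ultimately obtain us x bs where "ys = us @ x # bs"
        "2 * (\<Sum>x\<leftarrow>(as @ [y]) @ us. w x) \<le> (\<Sum>x\<leftarrow>(as @ [y]) @ ys. w x)"
        "2 * (\<Sum>x\<leftarrow>bs. w x) \<le> (\<Sum>x\<leftarrow>(as @ [y]) @ ys. w x)"
        using Cons.IH[of "as @ [y]"] by blast
      then show ?thesis
        by (intro exI[of _ "y # us"] exI[of _ x] exI[of _ bs]) simp
    qed
  qed simp
  moreover have "2 * (\<Sum>x\<leftarrow>[]. w x) \<le> (\<Sum>x\<leftarrow>[] @ xs. w x)"
    using assms(1) sum_list_nonneg[of "map w xs"] by auto
  ultimately show thesis
    using that assms by (metis append_Nil)
qed

lemma run_in_leaves: "run t q \<in> set (leaves t)"
  by (induction t) auto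

text \<open>The condition under which an ordered tree of any shape over the items can route by
  comparisons, so that balancing is free to choose the cuts. \<open>X x\<close> holds the queries
  belonging to item \<open>x\<close>; \<open>K\<close> will be \<open>UNIV\<close> for the directory
  and the window keys for repair.\<close>

definition separable :: "'u::linorder set \<Rightarrow> ('a \<Rightarrow> 'u set) \<Rightarrow> 'a list \<Rightarrow> bool" where
  "separable K X xs \<longleftrightarrow> (\<forall>us vs. xs = us @ vs \<and> us \<noteq> [] \<and> vs \<noteq> [] \<longrightarrow>
     (\<exists>c. key c \<in> K \<and> (\<forall>x\<in>set us. \<forall>q\<in>X x. holds c q) \<and> (\<forall>x\<in>set vs. \<forall>q\<in>X x. \<not> holds c q)))"

lemma separable_split:
  assumes "separable K X (us @ vs)" "us \<noteq> []" "vs \<noteq> []"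
  obtains c where "key c \<in> K" "\<And>x q. x \<in> set us \<Longrightarrow> q \<in> X x \<Longrightarrow> holds c q"
    "\<And>x q. x \<in> set vs \<Longrightarrow> q \<in> X x \<Longrightarrow> \<not> holds c q"
proof -
  have "\<exists>c. key c \<in> K \<and> (\<forall>x\<in>set us. \<forall>q\<in>X x. holds c q) \<and> (\<forall>x\<in>set vs. \<forall>q\<in>X x. \<not> holds c q)"
    using assms(1)[unfolded separable_def, rule_format, of us vs] assms(2,3) by simp
  then show thesis using that by blast
qed

lemma separable_appendD:
  assumes "separable K X (us @ vs)"
  shows "separable K X us" "separable K X vs"
proof -
  show "separable K X us"
    unfolding separable_def
  proof (intro allI impI, elim conjE)
    fix as bs assume *: "us = as @ bs" "as \<noteq> []" "bs \<noteq> []"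
    show "\<exists>c. key c \<in> K \<and> (\<forall>x\<in>set as. \<forall>q\<in>X x. holds c q) \<and> (\<forall>x\<in>set bs. \<forall>q\<in>X x. \<not> holds c q)"
    proof (rule separable_split[of K X as "bs @ vs"])
      show "separable K X (as @ bs @ vs)" using assms * by simp
    next
      fix c assume "key c \<in> K" "\<And>x q. x \<in> set as \<Longrightarrow> q \<in> X x \<Longrightarrow> holds c q"
        "\<And>x q. x \<in> set (bs @ vs) \<Longrightarrow> q \<in> X x \<Longrightarrow> \<not> holds c q"
      then show ?thesis by (intro exI[of _ c]) auto
    qed (use * in simp_all)
  qed
  show "separable K X vs"
    unfolding separable_def
  proof (intro allI impI, elim conjE)
    fix as bs assume *: "vs = as @ bs" "as \<noteq> []" "bs \<noteq> []"
    show "\<exists>c. key c \<in> K \<and> (\<forall>x\<in>set as. \<forall>q\<in>X x. holds c q) \<and> (\<forall>x\<in>set bs. \<forall>q\<in>X x. \<not> holds c q)"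
    proof (rule separable_split[of K X "us @ as" bs])
      show "separable K X ((us @ as) @ bs)" using assms * by simp
    next
      fix c assume "key c \<in> K" "\<And>x q. x \<in> set (us @ as) \<Longrightarrow> q \<in> X x \<Longrightarrow> holds c q"
        "\<And>x q. x \<in> set bs \<Longrightarrow> q \<in> X x \<Longrightarrow> \<not> holds c q"
      then show ?thesis by (intro exI[of _ c]) auto
    qed (use * in simp_all)
  qed
qed

lemma log_half_le:
  fixes v W p :: real
  assumes "2 * v \<le> W" "0 < p" "p \<le> v"
  shows "1 + log 2 (v / p) \<le> log 2 (W / p)"
proof -
  have "1 + log 2 (v / p) = log 2 (2 * v / p)"
    using assms by (simp add: log_mult log_divide)
  also have "\<dots> \<le> log 2 (W / p)"
    using assms by (intro log_mono) (auto intro!: divide_right_mono)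
  finally show ?thesis .
qed

text \<open>Splitting at a weighted median halves the weight at least once every two levels.\<close>

lemma alphabetic_tree:
  fixes w :: "'a \<Rightarrow> real" and X :: "'a \<Rightarrow> 'u::linorder set"
  assumes "\<And>x. x \<in> set xs \<Longrightarrow> 0 \<le> w x" "separable K X xs" "xs \<noteq> []"
  shows "\<exists>t. leaves t = map g xs \<and> keys t \<subseteq> K \<and> (\<forall>x\<in>set xs. \<forall>q\<in>X x. run t q = g x \<and>
    (0 < w x \<longrightarrow> real (comparisons t q) \<le> 2 * log 2 ((\<Sum>x\<leftarrow>xs. w x) / w x) + 2))"
  using assms
proof (induction "length xs" arbitrary: xs rule: less_induct)
  case less
  let ?W = "\<lambda>xs. \<Sum>x\<leftarrow>xs. w x"
  let ?ok = "\<lambda>t xs. leaves t = map g xs \<and> keys t \<subseteq> K \<and> (\<forall>x\<in>set xs. \<forall>q\<in>X x. run t q = g x \<and>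
    (0 < w x \<longrightarrow> real (comparisons t q) \<le> 2 * log 2 (?W xs / w x) + 2))"
  \<comment> \<open>The median gets a tip of its own between the halves: the tree is
    \<open>Cmp d s (Cmp c (Tip (g x)) t)\<close>, with shorter forms if a half is empty. Entering a
    half costs at most two comparisons and lowers the logarithm by at least 1, which the factor 2 in
    the bound pays for.\<close>
  obtain as x bs where xs: "xs = as @ x # bs"
    and half: "2 * ?W as \<le> ?W xs" "2 * ?W bs \<le> ?W xs"
    using median_split[OF less.prems(1,3)] .
  have member: "w y \<le> ?W ys" if "y \<in> set ys" "set ys \<subseteq> set xs" for y ys
    using member_le_sum_list[of "w y" "map w ys"] that less.prems(1) by auto
  have logx: "0 \<le> log 2 (?W xs / w y)" if "0 < w y" "y \<in> set xs" for y
    using member[OF that(2) subset_refl] that by simp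
  have IHa: "\<exists>t. ?ok t as" if "as \<noteq> []"
  proof (rule less.hyps)
    show "length as < length xs" by (simp add: xs)
    show "0 \<le> w y" if "y \<in> set as" for y using less.prems(1) that by (simp add: xs)
    show "separable K X as" using separable_appendD(1) less.prems(2) unfolding xs .
  qed (rule that)
  have IHb: "\<exists>t. ?ok t bs" if "bs \<noteq> []"
  proof (rule less.hyps)
    show "length bs < length xs" by (simp add: xs)
    show "0 \<le> w y" if "y \<in> set bs" for y using less.prems(1) that by (simp add: xs)
    show "separable K X bs"
      using separable_appendD(2)[of K X "as @ [x]" bs] less.prems(2) by (simp add: xs)
  qed (rule that)
  have loga: "1 + log 2 (?W as / w y) \<le> log 2 (?W xs / w y)" if "0 < w y" "y \<in> set as" for y
    by (rule log_half_le[OF half(1) that(1) member[OF that(2)]]) (auto simp: xs)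
  have logb: "1 + log 2 (?W bs / w y) \<le> log 2 (?W xs / w y)" if "0 < w y" "y \<in> set bs" for y
    by (rule log_half_le[OF half(2) that(1) member[OF that(2)]]) (auto simp: xs)
  show ?case
  proof (cases "bs = []")
    case bs: True
    show ?thesis
    proof (cases "as = []")
      case True
      show ?thesis
        using logx[of x] by (intro exI[of _ "Tip (g x)"]) (simp add: xs True bs)
    next
      case False
      then obtain t where t: "?ok t as" using IHa by blast
      obtain c where c: "key c \<in> K" "\<And>x q. x \<in> set as \<Longrightarrow> q \<in> X x \<Longrightarrow> holds c q"
        "\<And>y q. y \<in> set [x] \<Longrightarrow> q \<in> X y \<Longrightarrow> \<not> holds c q"
        using separable_split[of K X as "[x]"] less.prems(2) False unfolding xs bs by blast
      show ?thesis
      proof (intro exI[of _ "Cmp c t (Tip (g x))"] conjI ballI impI)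
        fix y q assume y: "y \<in> set xs" "q \<in> X y"
        show "run (Cmp c t (Tip (g x))) q = g y"
        proof (cases "y \<in> set as")
          case True
          then show ?thesis using c(2)[OF True y(2)] t y by simp
        next
          case False
          then show ?thesis using c(3)[of y q] y by (simp add: xs bs)
        qed
        assume "0 < w y"
        then show "real (comparisons (Cmp c t (Tip (g x))) q) \<le> 2 * log 2 (?W xs / w y) + 2"
        proof (cases "q \<in> X x")
          case True
          then have "\<not> holds c q" using c(3) by simp
          then show ?thesis using logx[of y] y \<open>0 < w y\<close> by simp
        next
          case False
          then have ya: "y \<in> set as" using y by (auto simp: xs bs)
          then have "holds c q" using c(2) y by blast
          moreover have "real (comparisons t q) \<le> 2 * log 2 (?W as / w y) + 2"
            using t ya y \<open>0 < w y\<close> by blast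
          ultimately show ?thesis using loga[OF \<open>0 < w y\<close> ya] by simp
        qed
      next
        show "leaves (Cmp c t (Tip (g x))) = map g xs" using t by (simp add: xs bs)
        show "keys (Cmp c t (Tip (g x))) \<subseteq> K" using t c(1) by simp
      qed
    qed
  next
    case bs: False
    then obtain t where t: "?ok t bs" using IHb by blast
    obtain c where c: "key c \<in> K" "\<And>y q. y \<in> set [x] \<Longrightarrow> q \<in> X y \<Longrightarrow> holds c q"
      "\<And>x q. x \<in> set bs \<Longrightarrow> q \<in> X x \<Longrightarrow> \<not> holds c q"
    proof (rule separable_split[of K X "[x]" bs])
      show "separable K X ([x] @ bs)"
        using less.prems(2) separable_appendD(2)[of K X as "x # bs"] by (simp add: xs)
      show "[x] \<noteq> []" "bs \<noteq> []" using bs by simp_all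
    qed (rule that)
    let ?t = "Cmp c (Tip (g x)) t"
    have t': "leaves ?t = map g (x # bs)" "keys ?t \<subseteq> K"
      using t c(1) by simp_all
    have run_t': "run ?t q = g y" if "y \<in> set (x # bs)" "q \<in> X y" for y q
    proof (cases "y \<in> set bs")
      case True
      then show ?thesis using c(3)[OF True that(2)] t that by simp
    next
      case False
      then show ?thesis using c(2)[of y q] that by simp
    qed
    \<comment> \<open>The additive term is 1 instead of 2, which reserves one comparison for the
      root added when \<open>as\<close> is nonempty. An item of \<open>bs\<close> pays 2 (log - 1) +
      2 + 1, the median only 1.\<close>
    have cmp_t': "real (comparisons ?t q) \<le> 2 * log 2 (?W xs / w y) + 1"
      if "y \<in> set (x # bs)" "q \<in> X y" "0 < w y" for y q
    proof (cases "q \<in> X x")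
      case True
      then have "holds c q" using c by simp
      then have "comparisons ?t q = 1" by simp
      then show ?thesis using logx[of y] that by (auto simp: xs)
    next
      case False
      with that have y: "y \<in> set bs" by auto
      then have "\<not> holds c q" using c(3) that by blast
      moreover have "real (comparisons t q) \<le> 2 * log 2 (?W bs / w y) + 2"
        using t y that by blast
      ultimately show ?thesis using logb[OF that(3) y] by simp
    qed
    show ?thesis
    proof (cases "as = []")
      case True
      show ?thesis
      proof (intro exI[of _ ?t] conjI ballI impI)
        fix y q assume y: "y \<in> set xs" "q \<in> X y"
        then have y': "y \<in> set (x # bs)" by (simp add: xs True)
        show "run ?t q = g y" using run_t'[OF y' y(2)] .
        assume "0 < w y"
        then show "real (comparisons ?t q) \<le> 2 * log 2 (?W xs / w y) + 2"
          using cmp_t'[OF y' y(2)] by simp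
      next
        show "leaves ?t = map g xs" unfolding xs True using t'(1) by simp
        show "keys ?t \<subseteq> K" using t'(2) .
      qed
    next
      case False
      then obtain s where s: "?ok s as" using IHa by blast
      obtain d where d: "key d \<in> K" "\<And>x q. x \<in> set as \<Longrightarrow> q \<in> X x \<Longrightarrow> holds d q"
        "\<And>y q. y \<in> set (x # bs) \<Longrightarrow> q \<in> X y \<Longrightarrow> \<not> holds d q"
        using separable_split[of K X as "x # bs"] less.prems(2) False unfolding xs by blast
      show ?thesis
      proof (intro exI[of _ "Cmp d s ?t"] conjI ballI)
        show "leaves (Cmp d s ?t) = map g xs" "keys (Cmp d s ?t) \<subseteq> K"
          using s t' d(1) by (simp_all add: xs)
        fix y q assume y: "y \<in> set xs" "q \<in> X y"
        then consider "y \<in> set as" | "y \<in> set (x # bs)" by (auto simp: xs)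
        then have "run (Cmp d s ?t) q = g y \<and>
          (0 < w y \<longrightarrow> real (comparisons (Cmp d s ?t) q) \<le> 2 * log 2 (?W xs / w y) + 2)"
        proof cases
          case 1
          then have "holds d q" using d y by blast
          moreover have "run s q = g y"
            and "0 < w y \<Longrightarrow> real (comparisons s q) \<le> 2 * log 2 (?W as / w y) + 2"
            using s 1 y(2) by blast+
          ultimately show ?thesis using loga[OF _ 1] by force
        next
          case 2
          then have "\<not> holds d q" using d y by blast
          then show ?thesis using run_t'[OF 2 y(2)] cmp_t'[OF 2 y(2)] by simp
        qed
        then show "run (Cmp d s ?t) q = g y"
          and "0 < w y \<longrightarrow> real (comparisons (Cmp d s ?t) q) \<le> 2 * log 2 (?W xs / w y) + 2"
          by blast+
      qed
    qed
  qed
qed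

section \<open>Kraft sums and Gibbs' inequality\<close>

text \<open>The probability that a fair random walk down the tree, blind to the tests, ends at a tip
  labelled \<open>x\<close>. Collecting all tips with one label matters because a repair tree may
  output the same rank at several tips.\<close>

fun kraft :: "('u, 'l) cmp_tree \<Rightarrow> 'l \<Rightarrow> real" where
  "kraft (Tip l) x = (if l = x then 1 else 0)"
| "kraft (Cmp c s t) x = (kraft s x + kraft t x) / 2"

lemma kraft_nonneg: "0 \<le> kraft t x"
  by (induction t) auto

lemma sum_kraft_le_1: "finite A \<Longrightarrow> (\<Sum>x\<in>A. kraft t x) \<le> 1"
  by (induction t) (auto simp: sum.distrib simp flip: sum_divide_distrib)

lemma kraft_le_1: "kraft t x \<le> 1"
  using sum_kraft_le_1[of "{x}" t] by simp

text \<open>The tip that \<open>q\<close> reaches contributes exactly the left-hand side; other tips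
  with the same label can only add to it.\<close>

lemma power_comparisons_le_kraft: "(1 / 2) ^ comparisons t q \<le> kraft t (run t q)"
proof (induction t)
  case (Cmp c s t)
  have "kraft s x / 2 \<le> (kraft s x + kraft t x) / 2" "kraft t x / 2 \<le> (kraft s x + kraft t x) / 2" for x
    using kraft_nonneg[of s x] kraft_nonneg[of t x] by auto
  from this[of "run s q"] this[of "run t q"] Cmp show ?case
    by auto
qed simp

lemma kraft_run_pos: "0 < kraft t (run t q)"
proof -
  have "0 < (1 / 2 :: real) ^ comparisons t q" by simp
  then show ?thesis using power_comparisons_le_kraft by (rule less_le_trans)
qed

lemma log_kraft_le_comparisons: "log 2 (1 / kraft t (run t q)) \<le> real (comparisons t q)"
proof -
  have "log 2 ((1 / 2) ^ comparisons t q) \<le> log 2 (kraft t (run t q))"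
    using power_comparisons_le_kraft by (intro log_mono) auto
  then show ?thesis
    using kraft_run_pos[of t q] by (simp add: log_nat_power log_divide)
qed

text \<open>This is \<open>ln t \<le> t - 1\<close> at \<open>t = P * k x / p x\<close>, summed over
  \<open>A\<close>. The total \<open>P\<close> is not normalised, being 1 for the directory but the
  mass of a transcript cell for a repair tree. \<open>k_pos\<close> excludes the default value
  \<open>log 2 (1 / 0) = 0\<close>, which would make the right-hand side too small.\<close>

lemma gibbs:
  fixes p k :: "'a \<Rightarrow> real"
  assumes "finite A" and p: "\<And>x. x \<in> A \<Longrightarrow> 0 \<le> p x" and k: "\<And>x. x \<in> A \<Longrightarrow> 0 \<le> k x"
    and k_pos: "\<And>x. x \<in> A \<Longrightarrow> 0 < p x \<Longrightarrow> 0 < k x" and "(\<Sum>x\<in>A. k x) \<le> 1" and P: "(\<Sum>x\<in>A. p x) = P"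
  shows "(\<Sum>x\<in>A. p x * log 2 (P / p x)) \<le> (\<Sum>x\<in>A. p x * log 2 (1 / k x))"
proof -
  have "p x * ln (P / p x) - p x * ln (1 / k x) \<le> P * k x - p x" if "x \<in> A" for x
  proof (cases "p x = 0")
    case True
    then show ?thesis
      using k[OF that] sum_nonneg[of A p] p P by simp
  next
    case False
    with p that have "0 < p x" by force
    moreover from this have "0 < k x" using k_pos that by blast
    moreover have "0 < P"
      using \<open>0 < p x\<close> member_le_sum[of x A p] that p assms(1) P by fastforce
    ultimately have "p x * ln (P / p x) - p x * ln (1 / k x) = p x * ln (P * k x / p x)"
      by (simp add: ln_mult ln_div algebra_simps)
    also have "\<dots> \<le> p x * (P * k x / p x - 1)"
      using \<open>0 < p x\<close> \<open>0 < k x\<close> \<open>0 < P\<close> by (intro mult_left_mono ln_le_minus_one) auto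
    also have "\<dots> = P * k x - p x"
      using \<open>0 < p x\<close> by (simp add: field_simps)
    finally show ?thesis .
  qed
  then have "(\<Sum>x\<in>A. p x * ln (P / p x) - p x * ln (1 / k x)) \<le> (\<Sum>x\<in>A. P * k x - p x)"
    by (rule sum_mono)
  also have "\<dots> = P * (\<Sum>x\<in>A. k x) - P"
    by (simp add: sum_subtractf P sum_distrib_left)
  also have "\<dots> \<le> 0"
    using mult_left_mono[of "\<Sum>x\<in>A. k x" 1 P] assms(5) sum_nonneg[of A p] p P by simp
  finally have "(\<Sum>x\<in>A. p x * ln (P / p x)) \<le> (\<Sum>x\<in>A. p x * ln (1 / k x))"
    by (simp add: sum_subtractf)
  then show ?thesis
    by (simp add: log_def divide_right_mono flip: sum_divide_distrib)
qed

subsection \<open>Removing gaps from a partition\<close>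

lemma holds_mono: "holds c q' \<Longrightarrow> q \<le> q' \<Longrightarrow> holds c q"
  by (cases c) auto

text \<open>Only the cut right after \<open>x\<close> asks for a new comparison. A cut further right
  is made by a comparison that holds at some query of a nonempty item above \<open>x\<close>, hence
  by \<open>holds_mono\<close> at all of \<open>X x\<close>.\<close>

lemma separable_Cons:
  assumes xs: "separable K X xs"
    and c: "xs \<noteq> [] \<Longrightarrow> \<exists>c. key c \<in> K \<and> (\<forall>q\<in>X x. holds c q) \<and> (\<forall>y\<in>set xs. \<forall>q\<in>X y. \<not> holds c q)"
    and less: "\<And>y q q'. y \<in> set xs \<Longrightarrow> q \<in> X x \<Longrightarrow> q' \<in> X y \<Longrightarrow> q < q'"
    and ne: "\<And>y. y \<in> set xs \<Longrightarrow> X y \<noteq> {}"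
  shows "separable K X (x # xs)"
  unfolding separable_def
proof (intro allI impI, elim conjE)
  fix us vs assume *: "x # xs = us @ vs" "us \<noteq> []" "vs \<noteq> []"
  then obtain us' where us: "us = x # us'" "xs = us' @ vs" by (cases us) auto
  show "\<exists>c. key c \<in> K \<and> (\<forall>x\<in>set us. \<forall>q\<in>X x. holds c q) \<and> (\<forall>x\<in>set vs. \<forall>q\<in>X x. \<not> holds c q)"
  proof (cases "us' = []")
    case True
    then show ?thesis using c us *(3) by simp
  next
    case False
    obtain c where c: "key c \<in> K" "\<And>y q. y \<in> set us' \<Longrightarrow> q \<in> X y \<Longrightarrow> holds c q"
      "\<And>y q. y \<in> set vs \<Longrightarrow> q \<in> X y \<Longrightarrow> \<not> holds c q"
      using xs False *(3) unfolding separable_def us(2) by (metis (no_types, lifting))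
    obtain y where y: "y \<in> set us'" using False by (cases us') auto
    then obtain q' where "q' \<in> X y" using ne us(2) by fastforce
    then have "holds c q" if "q \<in> X x" for q
      using c(2)[OF y] less[of y q q'] that y us(2) holds_mono[of c q' q] by simp
    then show ?thesis using c us(1) by auto
  qed
qed

lemma key_rank_Ioo:
  assumes "S \<inter> {p<..<k} = {}" "p < q" "q < k"
  shows "key_rank S q = key_rank S p"
proof -
  have "x \<le> q \<longleftrightarrow> x \<le> p" if "x \<in> S" for x
  proof
    assume "x \<le> q"
    then have "x < k" using assms(3) by simp
    moreover have "x \<notin> {p<..<k}" using assms(1) that by blast
    ultimately show "x \<le> p" by simp
  qed (use assms(2) in simp)
  then have "{x \<in> S. x \<le> q} = {x \<in> S. x \<le> p}" by blast
  then show ?thesis by (simp add: key_rank_def)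
qed

lemma order_convex_intervals:
  "order_convex {..k}" "order_convex {k..}" "order_convex {k<..<k'}"
  unfolding order_convex_def by auto

lemma order_convex_Int: "order_convex I \<Longrightarrow> order_convex J \<Longrightarrow> order_convex (I \<inter> J)"
  unfolding order_convex_def by blast

text \<open>\<open>ordered_partition\<close> without the covering condition and with labels
  attached, so that it passes to tails of the list in an induction.\<close>

definition consecutive :: "('u::linorder set \<times> 'a) list \<Rightarrow> bool" where
  "consecutive ps \<longleftrightarrow> (\<forall>p\<in>set ps. fst p \<noteq> {} \<and> order_convex (fst p)) \<and>
     sorted_wrt (\<lambda>p p'. \<forall>x\<in>fst p. \<forall>y\<in>fst p'. x < y) ps"

lemma consecutive_Cons:
  "consecutive (p # ps) \<longleftrightarrow> fst p \<noteq> {} \<and> order_convex (fst p) \<and>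
     (\<forall>p'\<in>set ps. \<forall>x\<in>fst p. \<forall>y\<in>fst p'. x < y) \<and> consecutive ps"
  by (auto simp: consecutive_def)

text \<open>Stands in for the covering condition: a tail of an ordered partition covers an upper
  set.\<close>

definition upper_set :: "'u::linorder set \<Rightarrow> bool" where
  "upper_set U \<longleftrightarrow> (\<forall>x\<in>U. {x..} \<subseteq> U)"

lemma upper_setD: "upper_set U \<Longrightarrow> x \<in> U \<Longrightarrow> x \<le> q \<Longrightarrow> q \<in> U"
  by (auto simp: upper_set_def)

text \<open>A cut of the universe is a gap if no comparison realises it.  Around a gap between two parts
  of the partition, a part without keys is split off; it gets the label \<open>None\<close>, and its weight
  dominates the weights of both neighbours it was taken from.\<close>

locale refinement =
  fixes S :: "'u::linorder set" and f :: "'l \<Rightarrow> real" and ps :: "('u set \<times> 'l) list"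
    and zs :: "('u set \<times> 'l option \<times> real) list"
  assumes nonempty: "zs \<noteq> []"
    and consecutive: "consecutive zs"
    and union: "\<Union>(fst ` set zs) = \<Union>(fst ` set ps)"
    and separable: "separable UNIV fst zs"
    and labels: "List.map_filter (fst \<circ> snd) zs = map snd ps"
    and rank_constant: "(X, None, w) \<in> set zs \<Longrightarrow> q \<in> X \<Longrightarrow> q' \<in> X \<Longrightarrow> key_rank S q = key_rank S q'"
    and subpart: "(X, Some l, w) \<in> set zs \<Longrightarrow> \<exists>Y. (Y, l) \<in> set ps \<and> X \<subseteq> Y"
    and weight_nonneg: "z \<in> set zs \<Longrightarrow> 0 \<le> snd (snd z)"
    and weight: "z \<in> set zs \<Longrightarrow> p \<in> set ps \<Longrightarrow> q \<in> fst z \<Longrightarrow> q \<in> fst p \<Longrightarrow> f (snd p) \<le> snd (snd z)"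
    and total_weight: "(\<Sum>z\<leftarrow>zs. snd (snd z)) + f (snd (hd ps)) \<le> 3 * (\<Sum>p\<leftarrow>ps. f (snd p))"

lemma refinement_singleton:
  assumes "consecutive [(X, l)]" "0 \<le> f l"
  shows "refinement S f [(X, l)] [(X, Some l, f l)]"
  using assms
  by unfold_locales (auto simp: consecutive_def separable_def Cons_eq_append_conv List.map_filter_simps)

lemma refinement_separated:
  fixes S :: "'u::linorder set" and ps :: "('u set \<times> 'l) list"
  assumes ps: "consecutive ((X, l) # ps)" "ps \<noteq> []" and f: "\<And>l. 0 \<le> f l"
    and c: "\<And>q. q \<in> X \<Longrightarrow> holds c q" "\<And>p q. p \<in> set ps \<Longrightarrow> q \<in> fst p \<Longrightarrow> \<not> holds c q"
    and zs: "refinement S f ps zs"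
  shows "refinement S f ((X, l) # ps) ((X, Some l, f l) # zs)"
proof -
  interpret zs: refinement S f ps zs by (rule zs)
  have below: "x < y" if "x \<in> X" "z \<in> set zs" "y \<in> fst z" for x y z
    using that zs.union ps(1) by (fastforce simp: consecutive_Cons)
  have disjoint: "q \<notin> X" if "p \<in> set ps" "q \<in> fst p" for p q
    using that ps(1) by (fastforce simp: consecutive_Cons)
  have cons: "consecutive ((X, Some l, f l) # zs)"
    using below zs.consecutive ps(1) by (auto simp: consecutive_Cons)
  have sep: "separable UNIV fst ((X, Some l, f l) # zs)"
  proof (rule separable_Cons[OF zs.separable])
    have "\<not> holds c q" if "z \<in> set zs" "q \<in> fst z" for z q
      using that zs.union c(2) by blast
    then show "\<exists>c. key c \<in> UNIV \<and> (\<forall>q\<in>fst (X, Some l, f l). holds c q) \<and>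
        (\<forall>y\<in>set zs. \<forall>q\<in>fst y. \<not> holds c q)"
      using c(1) by (intro exI[of _ c]) simp
  qed (use below zs.consecutive in \<open>auto simp: consecutive_def\<close>)
  have weight: "f (snd p) \<le> snd (snd z)"
    if z: "z \<in> set ((X, Some l, f l) # zs)" and p: "p \<in> set ((X, l) # ps)"
      and q: "q \<in> fst z" "q \<in> fst p" for z p q
  proof (cases "p \<in> set ps")
    case True
    then have "z \<in> set zs" using disjoint[OF True q(2)] z q(1) by auto
    then show ?thesis using zs.weight True q by blast
  next
    case False
    then have p': "p = (X, l)" using p by simp
    then have "z \<notin> set zs" using q zs.union disjoint by fastforce
    then show ?thesis using z p' by simp
  qed
  have sum: "(\<Sum>z\<leftarrow>(X, Some l, f l) # zs. snd (snd z)) + f (snd (hd ((X, l) # ps)))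
      \<le> 3 * (\<Sum>p\<leftarrow>(X, l) # ps. f (snd p))"
    using zs.total_weight f[of l] f[of "snd (hd ps)"] by simp
  show ?thesis
  proof
    show "f (snd p) \<le> snd (snd z)"
      if "z \<in> set ((X, Some l, f l) # zs)" "p \<in> set ((X, l) # ps)" "q \<in> fst z" "q \<in> fst p" for z p q
      using weight[OF that] .
    show "\<exists>Y. (Y, l') \<in> set ((X, l) # ps) \<and> X' \<subseteq> Y"
      if "(X', Some l', w) \<in> set ((X, Some l, f l) # zs)" for X' l' w
      using zs.subpart[of X' l' w] that by auto
    show "key_rank S q = key_rank S q'"
      if "(X', None, w) \<in> set ((X, Some l, f l) # zs)" "q \<in> X'" "q' \<in> X'" for X' w q q'
      using zs.rank_constant[of X' w q q'] that by simp
    show "0 \<le> snd (snd z)" if "z \<in> set ((X, Some l, f l) # zs)" for z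
      using that zs.weight_nonneg[of z] f by auto
  qed (use cons sep sum zs.union zs.labels in \<open>simp_all add: List.map_filter_simps\<close>)
qed

text \<open>The gap part is cut off by \<open>Le k\<close> and \<open>Lt k'\<close>;
  \<open>k\<close> stays in the left neighbour and \<open>k'\<close> in the right one, so neither
  becomes empty. Weights hang on labels, so trimming \<open>Y\<close> leaves \<open>f m\<close>
  unchanged. The extra summand in \<open>total_weight\<close> is a reserve: the \<open>f m\<close>
  reserved by \<open>zs\<close> pays for the share of \<open>m\<close> in the gap part, while
  \<open>f l\<close> is paid three times, for its own part, for the gap and as the new
  reserve.\<close>

lemma refinement_gap:
  fixes S :: "'u::linorder set" and ps :: "('u set \<times> 'l) list"
  assumes ps: "consecutive ((X, l) # (Y, m) # ps)" and f: "\<And>l. 0 \<le> f l"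
    and upper: "upper_set (\<Union>(fst ` set ((X, l) # (Y, m) # ps)))"
    and k: "k \<in> X" "k' \<in> Y" "S \<inter> {k<..<k'} = {}" "\<exists>q\<in>X. k < q"
    and zs: "refinement S f ((Y \<inter> {k'..}, m) # ps) zs"
  shows "refinement S f ((X, l) # (Y, m) # ps)
    ((X \<inter> {..k}, Some l, f l) # ({k<..<k'}, None, f l + f m) # zs)"
proof -
  interpret zs: refinement S f "(Y \<inter> {k'..}, m) # ps" zs by (rule zs)
  let ?zs = "(X \<inter> {..k}, Some l, f l) # ({k<..<k'}, None, f l + f m) # zs"
  have XY: "x < y" if "x \<in> X" "y \<in> Y" for x y
    using ps that by (auto simp: consecutive_Cons)
  have Xps: "x < y" if "x \<in> X" "p \<in> set ps" "y \<in> fst p" for x y p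
    using ps that by (auto simp: consecutive_Cons)
  have Yps: "x < y" if "x \<in> Y" "p \<in> set ps" "y \<in> fst p" for x y p
    using ps that by (auto simp: consecutive_Cons)
  have kk': "k < k'" using XY k by blast
  have zs_ge: "k' \<le> y" if "z \<in> set zs" "y \<in> fst z" for z y
  proof -
    have "y \<in> Y \<inter> {k'..} \<or> (\<exists>p\<in>set ps. y \<in> fst p)" using zs.union that by fastforce
    then show ?thesis using Yps k(2) by (auto intro: less_imp_le)
  qed
  \<comment> \<open>Covering is available only from \<open>k\<close> upwards, through
    \<open>upper\<close>; the parts after \<open>Y\<close> lie above \<open>k'\<close> and cannot
    contain \<open>q\<close>.\<close>
  have gap: "q \<in> X \<or> q \<in> Y" if "k < q" "q < k'" for q
  proof -
    have "q \<in> \<Union>(fst ` set ((X, l) # (Y, m) # ps))"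
      by (rule upper_setD[OF upper, of k]) (use k(1) that in simp_all)
    moreover have "q \<notin> fst p" if "p \<in> set ps" for p
      using Yps[OF k(2) that, of q] \<open>q < k'\<close> by auto
    ultimately show ?thesis by auto
  qed
  have union: "\<Union>(fst ` set ?zs) = \<Union>(fst ` set ((X, l) # (Y, m) # ps))"
  proof -
    have "\<Union>(fst ` set ?zs) = X \<inter> {..k} \<union> {k<..<k'} \<union> (Y \<inter> {k'..} \<union> \<Union>(fst ` set ps))"
      using zs.union by (simp add: Un_assoc)
    also have "\<dots> = X \<union> (Y \<union> \<Union>(fst ` set ps))"
    proof -
      have "X \<subseteq> X \<inter> {..k} \<union> {k<..<k'}"
        using XY[OF _ k(2)] by (simp add: subset_iff) (meson not_le)
      moreover have "Y \<subseteq> {k<..<k'} \<union> Y \<inter> {k'..}"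
        using XY[OF k(1)] by (simp add: subset_iff) (meson not_le)
      moreover have "{k<..<k'} \<subseteq> X \<union> Y" by (rule subsetI) (use gap in simp)
      ultimately show ?thesis by blast
    qed
    finally show ?thesis by simp
  qed
  have conv: "order_convex (X \<inter> {..k})" "order_convex {k<..<k'}"
    using ps by (simp_all add: consecutive_Cons order_convex_Int order_convex_intervals)
  obtain q where "q \<in> X" "k < q" using k(4) by blast
  then have "q \<in> {k<..<k'}" using XY k(2) by simp
  then have nonempty: "{k<..<k'} \<noteq> {}" by blast
  have below_gap: "x < y" if "x \<in> {k<..<k'}" "z \<in> set zs" "y \<in> fst z" for x y z
    using less_le_trans[OF _ zs_ge[OF that(2,3)]] that(1) by simp
  have below: "x < y" if "x \<in> X \<inter> {..k}" "z \<in> set (({k<..<k'}, None, f l + f m) # zs)" "y \<in> fst z"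
    for x y z
  proof (cases "z \<in> set zs")
    case True
    have "k < y" using kk' zs_ge[OF True that(3)] by (rule less_le_trans)
    then show ?thesis using that(1) by auto
  next
    case False
    then show ?thesis using that by auto
  qed
  have cons: "consecutive ?zs"
    unfolding consecutive_Cons fst_conv
  proof (intro conjI ballI)
    show "X \<inter> {..k} \<noteq> {}" using k(1) by blast
  qed (use below below_gap conv nonempty zs.consecutive in blast)+
  have sep: "separable UNIV fst ?zs"
  proof (rule separable_Cons[OF separable_Cons[OF zs.separable]])
    show "\<exists>c. key c \<in> UNIV \<and> (\<forall>q\<in>fst ({k<..<k'}, None, f l + f m). holds c q) \<and>
        (\<forall>y\<in>set zs. \<forall>q\<in>fst y. \<not> holds c q)"
      using zs_ge by (intro exI[of _ "Lt k'"]) (simp add: not_less)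
    show "\<exists>c. key c \<in> UNIV \<and> (\<forall>q\<in>fst (X \<inter> {..k}, Some l, f l). holds c q) \<and>
        (\<forall>y\<in>set (({k<..<k'}, None, f l + f m) # zs). \<forall>q\<in>fst y. \<not> holds c q)"
      using less_le_trans[OF kk' zs_ge] by (intro exI[of _ "Le k"]) (simp add: not_le)
    show "q < q'" if "z \<in> set zs" "q \<in> fst ({k<..<k'}, None, f l + f m)" "q' \<in> fst z" for z q q'
      using below_gap[of q z q'] that by simp
    show "q < q'" if "z \<in> set (({k<..<k'}, None, f l + f m) # zs)"
        "q \<in> fst (X \<inter> {..k}, Some l, f l)" "q' \<in> fst z" for z q q'
      using below[OF _ that(1,3), of q] that(2) by simp
    show "fst z \<noteq> {}" if "z \<in> set zs" for z
      using cons that by (simp add: consecutive_def)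
    show "fst z \<noteq> {}" if "z \<in> set (({k<..<k'}, None, f l + f m) # zs)" for z
      using cons that unfolding consecutive_def by (meson list.set_intros(2))
  qed
  have weight: "f (snd p) \<le> snd (snd z)"
    if z: "z \<in> set ?zs" and p: "p \<in> set ((X, l) # (Y, m) # ps)"
      and q: "q \<in> fst z" "q \<in> fst p" for z p q
  proof -
    consider "z \<in> set zs" | "z = ({k<..<k'}, None, f l + f m)" | "z = (X \<inter> {..k}, Some l, f l)"
      using z by auto
    then show ?thesis
    proof cases
      case 1
      then have "k' \<le> q" using zs_ge q(1) by blast
      then have "q \<notin> X" using XY k(2) by fastforce
      then have "(p = (Y, m) \<and> q \<in> Y \<inter> {k'..}) \<or> p \<in> set ps"
        using p q \<open>k' \<le> q\<close> by auto
      then show ?thesis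
        using zs.weight[OF 1, of "(Y \<inter> {k'..}, m)" q] zs.weight[OF 1, of p q] q by auto
    next
      case 2
      then have "p \<notin> set ps" using q Yps[OF k(2), of p q] by auto
      then show ?thesis using p 2 f by auto
    next
      case 3
      then have "q \<in> X" using q by auto
      then have "p = (X, l)" using p q(2) XY[of q q] Xps[of q p q] by auto
      then show ?thesis using 3 by simp
    qed
  qed
  have sum: "(\<Sum>z\<leftarrow>?zs. snd (snd z)) + f (snd (hd ((X, l) # (Y, m) # ps)))
      \<le> 3 * (\<Sum>p\<leftarrow>(X, l) # (Y, m) # ps. f (snd p))"
    using zs.total_weight by simp
  show ?thesis
  proof
    show "f (snd p) \<le> snd (snd z)"
      if "z \<in> set ?zs" "p \<in> set ((X, l) # (Y, m) # ps)" "q \<in> fst z" "q \<in> fst p" for z p q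
      using weight[OF that] .
    show "\<exists>Y'. (Y', l') \<in> set ((X, l) # (Y, m) # ps) \<and> X' \<subseteq> Y'"
      if "(X', Some l', w) \<in> set ?zs" for X' l' w
      using zs.subpart[of X' l' w] that by auto
    show "key_rank S q = key_rank S q'"
      if "(X', None, w) \<in> set ?zs" "q \<in> X'" "q' \<in> X'" for X' w q q'
      using zs.rank_constant[of X' w q q'] key_rank_Ioo[OF k(3), of q] key_rank_Ioo[OF k(3), of q'] that
      by auto
    show "0 \<le> snd (snd z)" if "z \<in> set ?zs" for z
      using that zs.weight_nonneg[of z] f by auto
  qed (use cons sep sum union zs.labels in \<open>simp_all add: List.map_filter_simps\<close>)
qed

text \<open>If no comparison realises the cut after the first interval, that interval has no
  greatest element, which leaves room for a nonempty gap part. Finiteness of \<open>S\<close> lets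
  \<open>k\<close> and \<open>k'\<close> be chosen so close to the cut that no key lies between
  them.\<close>

lemma ex_refinement:
  fixes S :: "'u::linorder set" and ps :: "('u set \<times> 'l) list"
  assumes "finite S" and f: "\<And>l. 0 \<le> f l"
    and "consecutive ps" "ps \<noteq> []" "upper_set (\<Union>(fst ` set ps))"
  shows "\<exists>zs. refinement S f ps zs"
proof -
  \<comment> \<open>The first interval is a variable of the induction, because after a gap the
    recursion continues with it trimmed to \<open>{k'..}\<close>.\<close>
  have "\<exists>zs. refinement S f ((X, l) # ps) zs"
    if "consecutive ((X, l) # ps)" "upper_set (\<Union>(fst ` set ((X, l) # ps)))" for X l ps
    using that
  proof (induction ps arbitrary: X l)
    case Nil
    then show ?case using refinement_singleton[of X l f S] f by blast
  next
    case (Cons p ps)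
    obtain Y m where p: "p = (Y, m)" by fastforce
    have XY: "x < y" if "x \<in> X" "y \<in> Y" for x y
      using Cons.prems(1) that by (auto simp: consecutive_Cons p)
    have Xps: "x < y" if "x \<in> X" "p \<in> set ps" "y \<in> fst p" for x y p
      using Cons.prems(1) that by (auto simp: consecutive_Cons p)
    have Yps: "x < y" if "x \<in> Y" "p \<in> set ps" "y \<in> fst p" for x y p
      using Cons.prems(1) that by (auto simp: consecutive_Cons p)
    \<comment> \<open>\<open>K = UNIV\<close> serves the separated case and
      \<open>K = {k'..}\<close> the gap case.\<close>
    have tail_upper: "upper_set (Y \<inter> K \<union> \<Union>(fst ` set ps))"
      if "k' \<in> Y" and K: "K = {k'..} \<or> K = UNIV" for K k'
      unfolding upper_set_def
    proof (intro ballI subsetI)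
      fix x q assume x: "x \<in> Y \<inter> K \<union> \<Union>(fst ` set ps)" and "q \<in> {x..}"
      then have xq: "x \<le> q" by simp
      have "q \<in> \<Union>(fst ` set ((X, l) # p # ps))"
        by (rule upper_setD[OF Cons.prems(2) _ xq]) (use x in \<open>auto simp: p\<close>)
      moreover have "q \<notin> X" 
        using x xq XY Xps by (fastforce)
      moreover have "q \<in> K" if "q \<in> Y"
      proof -
        have "x \<in> Y \<inter> K" using x Yps that xq by fastforce
        then show ?thesis using K xq by auto
      qed
      ultimately show "q \<in> Y \<inter> K \<union> \<Union>(fst ` set ps)" by (auto simp: p)
    qed
    have Y: "Y \<noteq> {}" "order_convex Y" "X \<noteq> {}"
      using Cons.prems(1) by (auto simp: consecutive_Cons p)
    show ?case
    proof (cases "\<exists>c. (\<forall>q\<in>X. holds c q) \<and> (\<forall>p\<in>set (p # ps). \<forall>q\<in>fst p. \<not> holds c q)")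
      case True
      then obtain c where c: "\<And>q. q \<in> X \<Longrightarrow> holds c q"
        "\<And>p' q. p' \<in> set (p # ps) \<Longrightarrow> q \<in> fst p' \<Longrightarrow> \<not> holds c q"
        by blast
      obtain k' where "k' \<in> Y" using Y by blast
      obtain zs where zs: "refinement S f (p # ps) zs"
        using Cons.IH[of Y m] Cons.prems(1) tail_upper[OF \<open>k' \<in> Y\<close>, of UNIV]
        by (auto simp: p consecutive_Cons)
      have "refinement S f ((X, l) # p # ps) ((X, Some l, f l) # zs)"
        by (rule refinement_separated[OF Cons.prems(1) _ f c(1) c(2) zs]) simp_all
      then show ?thesis by blast
    next
      case False
      \<comment> \<open>A greatest element \<open>k\<close> of \<open>X\<close> would make
        \<open>Le k\<close> a comparison realising the cut.\<close>
      have X_max: "\<exists>q\<in>X. k < q" if "k \<in> X" for k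
      proof (rule ccontr)
        assume "\<not> (\<exists>q\<in>X. k < q)"
        then have "(\<forall>q\<in>X. holds (Le k) q) \<and> (\<forall>p\<in>set (p # ps). \<forall>q\<in>fst p. \<not> holds (Le k) q)"
          using XY[OF that] Xps[OF that] by (auto simp: not_less not_le p)
        with False show False by blast
      qed
      \<comment> \<open>The greatest key in \<open>X\<close> serves as \<open>k\<close>; if
        \<open>X\<close> contains no key, any element does. \<open>key_below\<close> is the mirror
        image for \<open>Y\<close>.\<close>
      have key_above: "\<exists>k\<in>X. \<forall>x\<in>S \<inter> X. x \<le> k"
      proof (cases "S \<inter> X = {}")
        case True
        then show ?thesis using Y by blast
      next
        case False
        then have "Max (S \<inter> X) \<in> X" using Max_in[of "S \<inter> X"] \<open>finite S\<close> by blast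
        then show ?thesis using \<open>finite S\<close> by (meson Max_ge finite_Int)
      qed
      have key_below: "\<exists>k\<in>Y. \<forall>x\<in>S \<inter> Y. k \<le> x"
      proof (cases "S \<inter> Y = {}")
        case True
        then show ?thesis using Y by blast
      next
        case False
        then have "Min (S \<inter> Y) \<in> Y" using Min_in[of "S \<inter> Y"] \<open>finite S\<close> by blast
        then show ?thesis using \<open>finite S\<close> by (meson Min_le finite_Int)
      qed
      obtain k k' where k: "k \<in> X" "\<And>x. x \<in> S \<Longrightarrow> x \<in> X \<Longrightarrow> x \<le> k"
        and k': "k' \<in> Y" "\<And>x. x \<in> S \<Longrightarrow> x \<in> Y \<Longrightarrow> k' \<le> x"
        using key_above key_below by blast
      have empty: "S \<inter> {k<..<k'} = {}"
      proof (rule ccontr)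
        assume "S \<inter> {k<..<k'} \<noteq> {}"
        then obtain x where x: "x \<in> S" "k < x" "x < k'" by auto
        have "x \<in> \<Union>(fst ` set ((X, l) # p # ps))"
          by (rule upper_setD[OF Cons.prems(2), of k]) (use k(1) x in simp_all)
        moreover have "x \<notin> X" "x \<notin> Y" using x k(2)[of x] k'(2)[of x] by auto
        moreover have "x \<notin> fst p'" if "p' \<in> set ps" for p'
          using Yps[OF k'(1) that, of x] x by auto
        ultimately show False by (auto simp: p)
      qed
      have "order_convex (Y \<inter> {k'..})"
        using Y(2) by (simp add: order_convex_Int order_convex_intervals)
      then have "consecutive ((Y \<inter> {k'..}, m) # ps)"
        using Cons.prems(1) k'(1) by (auto simp: consecutive_Cons p)
      then obtain zs where "refinement S f ((Y \<inter> {k'..}, m) # ps) zs"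
        using Cons.IH[of "Y \<inter> {k'..}" m] tail_upper[OF k'(1), of "{k'..}"] by auto
      from refinement_gap[OF Cons.prems(1)[unfolded p] f Cons.prems(2)[unfolded p]
          k(1) k'(1) empty X_max[OF k(1)] this]
      show ?thesis unfolding p by blast
    qed
  qed
  then show ?thesis
    using assms(3-5) by (cases ps) auto
qed

subsection \<open>The cells of a configuration\<close>

lemma key_rank_le_card: "finite S \<Longrightarrow> key_rank S q \<le> card S"
  unfolding key_rank_def by (rule card_mono) auto

lemma key_rank_mono: "finite S \<Longrightarrow> q \<le> q' \<Longrightarrow> key_rank S q \<le> key_rank S q'"
  unfolding key_rank_def by (rule card_mono) auto

lemma finite_key_rank: "finite S \<Longrightarrow> finite (key_rank S ` I)"
  by (rule finite_subset[of _ "{..card S}"]) (auto simp: key_rank_le_card)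

text \<open>At a fixed leaf the window is a function of the predicted value, so only value and side
  information can tell queries apart. With the empty predictor all queries share one
  transcript.\<close>

lemma transcript_eq_iff:
  "transcript S M l q = transcript S M l q' \<longleftrightarrow>
    model l = [] \<or> predict M (model l) q = predict M (model l) q' \<and>
      side_info M (model l) q = side_info M (model l) q'"
  by (auto simp: transcript_def window_def)

lemma finite_transcripts:
  assumes "certified S M l"
  shows "finite (transcript S M l ` interval l)"
proof (cases "model l = []")
  case True
  then show ?thesis by (simp add: transcript_def window_def image_constant_conv)
next
  case False
  let ?F = "\<lambda>(v, s). \<lparr>tr_leaf = interval l, tr_model = model l, tr_value = Some v,
    tr_window = {r. r \<le> card S \<and> \<bar>v - real r\<bar> \<le> radius l}, tr_side = s\<rparr>"
  have "transcript S M l ` interval l \<subseteq>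
      ?F ` (predict M (model l) ` interval l \<times> side_info M (model l) ` interval l)"
    using False by (auto simp: transcript_def window_def intro!: image_eqI[where f = "?F"])
  moreover have "finite (predict M (model l) ` interval l \<times> side_info M (model l) ` interval l)"
    using assms False by (simp add: certified_def)
  ultimately show ?thesis
    by (rule finite_subset[OF _ finite_imageI])
qed

lemma key_rank_in_window:
  assumes "finite S" "certified S M l" "q \<in> interval l"
  shows "key_rank S q \<in> window S M l q"
  using assms by (auto simp: window_def certified_def key_rank_le_card finite_key_rank)

lemma configuration_consecutive:
  assumes "configuration S M ls"
  shows "consecutive (map (\<lambda>l. (interval l, l)) ls)"
  using assms by (auto simp: configuration_def ordered_partition_def consecutive_def sorted_wrt_map)

lemma configurationD:
  assumes "configuration S M ls"
  shows "(\<Union>l\<in>set ls. interval l) = UNIV"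
    and "\<And>l. l \<in> set ls \<Longrightarrow> interval l \<noteq> {}"
    and "\<And>l. l \<in> set ls \<Longrightarrow> order_convex (interval l)"
    and "\<And>l. l \<in> set ls \<Longrightarrow> model l \<in> models M (atoms l)"
    and "\<And>l. l \<in> set ls \<Longrightarrow> certified S M l"
  using assms by (auto simp: configuration_def ordered_partition_def)

lemma sorted_intervals_disjoint:
  fixes X :: "'a \<Rightarrow> 'u::order set"
  assumes "sorted_wrt (\<lambda>l l'. \<forall>x\<in>X l. \<forall>y\<in>X l'. x < y) ls"
    "l \<in> set ls" "l' \<in> set ls" "q \<in> X l" "q \<in> X l'"
  shows "l = l'"
  using assms by (induction ls) auto

lemma sorted_intervals_distinct:
  fixes X :: "'a \<Rightarrow> 'u::order set"
  assumes "sorted_wrt (\<lambda>l l'. \<forall>x\<in>X l. \<forall>y\<in>X l'. x < y) ls" "\<And>l. l \<in> set ls \<Longrightarrow> X l \<noteq> {}"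
  shows "distinct ls"
  using assms
proof (induction ls)
  case (Cons l ls)
  obtain q where "q \<in> X l" using Cons.prems(2)[of l] by auto
  then have "l \<notin> set ls" using Cons.prems(1) by auto
  then show ?case using Cons by simp
qed simp

lemma configuration_disjoint:
  assumes "configuration S M ls" "l \<in> set ls" "l' \<in> set ls" "q \<in> interval l" "q \<in> interval l'"
  shows "l = l'"
  using assms sorted_intervals_disjoint[of interval ls l l' q]
  by (simp add: configuration_def ordered_partition_def sorted_wrt_map)

lemma configuration_distinct:
  assumes "configuration S M ls"
  shows "distinct ls"
  using assms sorted_intervals_distinct[of interval ls]
  by (simp add: configuration_def ordered_partition_def sorted_wrt_map)

definition transcript_cell ::
  "'u::linorder set \<Rightarrow> 'u model_family \<Rightarrow> 'u leaf \<Rightarrow> 'u transcript \<Rightarrow> 'u set" where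
  "transcript_cell S M l y = {q \<in> interval l. transcript S M l q = y}"

definition answer_cell ::
  "'u::linorder set \<Rightarrow> 'u model_family \<Rightarrow> 'u leaf \<Rightarrow> 'u transcript \<Rightarrow> nat \<Rightarrow> 'u set" where
  "answer_cell S M l y a = {q \<in> transcript_cell S M l y. key_rank S q = a}"

text \<open>The ranks range over all of \<open>{..card S}\<close>, attained or not, so that sums
  over cells are iterated sums with a fixed innermost index set; the additional cells are empty and
  have mass zero.\<close>

definition cells ::
  "'u::linorder set \<Rightarrow> 'u model_family \<Rightarrow> 'u leaf list \<Rightarrow> ('u leaf \<times> 'u transcript \<times> nat) set" where
  "cells S M ls = (SIGMA l : set ls. transcript S M l ` interval l \<times> {..card S})"

section \<open>Measurability and masses of cells, and the residual cost as a sum over them\<close>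

locale learning_problem =
  fixes S :: "'u::linorder set" and \<mu> :: "'u measure" and M :: "'u model_family" and \<beta> \<kappa> :: real
  assumes finite_keys: "finite S" and workload: "workload \<mu>"
    and family: "atomized_family \<beta> \<kappa> (card S) \<mu> M"
begin

sublocale prob_space \<mu>
  using workload by (simp add: workload_def)

lemma space_workload [simp]: "space \<mu> = UNIV"
  using workload by (simp add: workload_def)

lemma sets_order_convex: "order_convex I \<Longrightarrow> I \<in> sets \<mu>"
  using workload by (simp add: workload_def)

text \<open>The workload guarantees measurability of order-convex sets, and the level sets of the
  monotone rank function are order-convex.\<close>

lemma sets_key_rank: "{q. key_rank S q = a} \<in> sets \<mu>"
proof (rule sets_order_convex, unfold order_convex_def, safe)
  fix x y q assume "q \<in> {x..y}" "a = key_rank S x" "key_rank S y = key_rank S x"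
  then show "key_rank S q = key_rank S x"
    using key_rank_mono[OF finite_keys, of x q] key_rank_mono[OF finite_keys, of q y] by simp
qed

lemma sets_transcript_cell:
  assumes "order_convex (interval l)" "model l \<in> models M a"
  shows "transcript_cell S M l y \<in> sets \<mu>"
proof (cases "transcript_cell S M l y = {}")
  case False
  then obtain q0 where "q0 \<in> interval l" and y: "y = transcript S M l q0"
    by (auto simp: transcript_cell_def)
  have [measurable]: "predict M (model l) \<in> borel_measurable \<mu>"
    "side_info M (model l) \<in> measurable \<mu> (count_space UNIV)" "interval l \<in> sets \<mu>"
    using family assms sets_order_convex by (auto simp: atomized_family_def)
  have "{q \<in> space \<mu>. q \<in> interval l \<and> (model l = [] \<or> predict M (model l) q = predict M (model l) q0 \<and>
      side_info M (model l) q = side_info M (model l) q0)} \<in> sets \<mu>"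
    by measurable
  then show ?thesis by (simp add: transcript_cell_def y transcript_eq_iff)
qed simp

lemma sets_answer_cell:
  assumes "order_convex (interval l)" "model l \<in> models M a"
  shows "answer_cell S M l y r \<in> sets \<mu>"
proof -
  have "answer_cell S M l y r = transcript_cell S M l y \<inter> {q. key_rank S q = r}"
    by (auto simp: answer_cell_def)
  then show ?thesis using sets_transcript_cell[OF assms] sets_key_rank by auto
qed

lemma sum_measure_answer_cells:
  assumes "order_convex (interval l)" "model l \<in> models M a"
  shows "(\<Sum>r\<le>card S. measure \<mu> (answer_cell S M l y r)) = measure \<mu> (transcript_cell S M l y)"
proof -
  have "(\<Union>r\<le>card S. answer_cell S M l y r) = transcript_cell S M l y"
    using key_rank_le_card[OF finite_keys] by (auto simp: answer_cell_def)
  moreover have "disjoint_family_on (answer_cell S M l y) {..card S}"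
    by (auto simp: disjoint_family_on_def answer_cell_def)
  ultimately show ?thesis
    using finite_measure_finite_Union[of "{..card S}" "answer_cell S M l y"] sets_answer_cell[OF assms]
    by (simp add: image_subset_iff)
qed

lemma sum_measure_transcript_cells:
  assumes "order_convex (interval l)" "model l \<in> models M a" "certified S M l"
  shows "(\<Sum>y\<in>transcript S M l ` interval l. measure \<mu> (transcript_cell S M l y)) = measure \<mu> (interval l)"
proof -
  have "(\<Union>y\<in>transcript S M l ` interval l. transcript_cell S M l y) = interval l"
    by (auto simp: transcript_cell_def)
  moreover have "disjoint_family_on (transcript_cell S M l) (transcript S M l ` interval l)"
    by (auto simp: disjoint_family_on_def transcript_cell_def)
  ultimately show ?thesis
    using finite_measure_finite_Union[of "transcript S M l ` interval l" "transcript_cell S M l"]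
      sets_transcript_cell[OF assms(1,2)] finite_transcripts[OF assms(3)]
    by (simp add: image_subset_iff)
qed

lemma measure_answer_cell_le:
  assumes "order_convex (interval l)" "model l \<in> models M a"
  shows "measure \<mu> (answer_cell S M l y r) \<le> measure \<mu> (transcript_cell S M l y)"
  using sets_transcript_cell[OF assms] by (intro finite_measure_mono) (auto simp: answer_cell_def)

text \<open>In the conditional measure every cell mass is divided by the mass of the leaf. The
  division cancels inside the logarithm, and the factor in front undoes it outside, so that masses
  under \<mu> itself remain.\<close>

lemma repair_entropy_eq:
  assumes l: "order_convex (interval l)" "model l \<in> models M a" "certified S M l"
  shows "measure \<mu> (interval l) * repair_entropy S \<mu> M l =
    (\<Sum>y\<in>transcript S M l ` interval l. \<Sum>r\<le>card S. measure \<mu> (answer_cell S M l y r) *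
      log 2 (measure \<mu> (transcript_cell S M l y) / measure \<mu> (answer_cell S M l y r)))"
proof (cases "measure \<mu> (interval l) = 0")
  case True
  have "measure \<mu> (answer_cell S M l y r) \<le> measure \<mu> (interval l)" for y r
    using sets_order_convex[OF l(1)]
    by (intro finite_measure_mono) (auto simp: answer_cell_def transcript_cell_def)
  then have "measure \<mu> (answer_cell S M l y r) = 0" for y r
    using True by (simp add: measure_le_0_iff)
  then show ?thesis using True by simp
next
  case False
  let ?I = "interval l" and ?X = "key_rank S" and ?Y = "transcript S M l"
  let ?N = "cond_workload \<mu> ?I" and ?p = "measure \<mu> (interval l)"
  let ?c = "\<lambda>y r. measure \<mu> (answer_cell S M l y r)"
  let ?t = "\<lambda>y. measure \<mu> (transcript_cell S M l y)"
  have I: "?I \<in> sets \<mu>" using sets_order_convex l(1) .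
  have sets_N: "E \<in> sets ?N \<longleftrightarrow> E \<in> sets \<mu>" if "E \<subseteq> ?I" for E
    using that I by (simp add: cond_workload_def sets_restrict_space_iff)
  have space_N: "space ?N = ?I"
    by (simp add: cond_workload_def space_restrict_space)
  have restrict: "emeasure (restrict_space \<mu> ?I) E = emeasure \<mu> E"
    "measure (restrict_space \<mu> ?I) E = measure \<mu> E" if "E \<subseteq> ?I" for E
    using that I by (simp_all add: emeasure_restrict_space measure_restrict_space)
  have measure_N: "measure ?N E = measure \<mu> E / ?p" if "E \<in> sets \<mu>" "E \<subseteq> ?I" for E
  proof -
    have "measure ?N E = measure (restrict_space \<mu> ?I) (?I \<inter> E) / measure (restrict_space \<mu> ?I) ?I"
      unfolding cond_workload_def
      using that I False restrict[of ?I]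
      by (intro measure_uniform_measure) (auto simp: sets_restrict_space_iff emeasure_eq_measure)
    then show ?thesis using that restrict by (simp add: Int_absorb1)
  qed
  have "prob_space ?N"
    unfolding cond_workload_def using restrict[of ?I] False
    by (intro prob_space_uniform_measure) (auto simp: emeasure_eq_measure)
  then interpret N: information_space ?N 2
    by (simp add: information_space_def information_space_axioms_def)
  have t: "?Y -` {y} \<inter> space ?N = transcript_cell S M l y" for y
    by (auto simp: space_N transcript_cell_def)
  have c: "(\<lambda>q. (?X q, ?Y q)) -` {(r, y)} \<inter> space ?N = answer_cell S M l y r" for y r
    by (auto simp: space_N transcript_cell_def answer_cell_def)
  have in_I: "transcript_cell S M l y \<subseteq> ?I" "answer_cell S M l y r \<subseteq> ?I" for y r
    by (auto simp: transcript_cell_def answer_cell_def)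
  have finite_XY: "finite ((\<lambda>q. (?X q, ?Y q)) ` ?I)"
    by (rule finite_subset[of _ "{..card S} \<times> ?Y ` ?I"])
      (auto simp: finite_transcripts[OF l(3)] key_rank_le_card[OF finite_keys])
  have Y: "simple_distributed ?N ?Y (\<lambda>y. ?t y / ?p)"
  proof (rule N.simple_distributedI)
    show "simple_function ?N ?Y"
      unfolding simple_function_def t sets_N[OF in_I(1)]
      using finite_transcripts[OF l(3)] sets_transcript_cell[OF l(1,2)] by (simp add: space_N)
  qed (auto simp: t measure_N[OF sets_transcript_cell[OF l(1,2)] in_I(1)])
  have XY: "simple_distributed ?N (\<lambda>q. (?X q, ?Y q)) (\<lambda>(r, y). ?c y r / ?p)"
  proof (rule N.simple_distributedI)
    show "simple_function ?N (\<lambda>q. (?X q, ?Y q))"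
      unfolding simple_function_def using finite_XY
      by (auto simp: c sets_N[OF in_I(2)] sets_answer_cell[OF l(1,2)]) (simp add: space_N)
  next
    fix x assume "x \<in> (\<lambda>q. (?X q, ?Y q)) ` space ?N"
    show "(case x of (r, y) \<Rightarrow> ?c y r / ?p) = measure ?N ((\<lambda>q. (?X q, ?Y q)) -` {x} \<inter> space ?N)"
      by (cases x) (simp add: c measure_N[OF sets_answer_cell[OF l(1,2)] in_I(2)])
  qed auto
  have "repair_entropy S \<mu> M l =
      - (\<Sum>(r, y)\<in>(\<lambda>q. (?X q, ?Y q)) ` ?I. ?c y r / ?p * log 2 (?c y r / ?p / (?t y / ?p)))"
    using N.conditional_entropy_eq[OF Y XY] by (simp add: repair_entropy_def space_N)
  also have "?p * \<dots> =
      (\<Sum>(r, y)\<in>(\<lambda>q. (?X q, ?Y q)) ` ?I. ?c y r * log 2 (?t y / ?c y r))"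
    unfolding sum_negf[symmetric] sum_distrib_left
  proof (rule sum.cong, safe)
    fix q assume q: "q \<in> ?I"
    show "?p * - (?c (?Y q) (?X q) / ?p * log 2 (?c (?Y q) (?X q) / ?p / (?t (?Y q) / ?p))) =
      ?c (?Y q) (?X q) * log 2 (?t (?Y q) / ?c (?Y q) (?X q))"
    proof (cases "?c (?Y q) (?X q) = 0")
      case c0: False
      then have "0 < ?c (?Y q) (?X q)" by (simp add: zero_less_measure_iff)
      moreover from this have "0 < ?t (?Y q)"
        using measure_answer_cell_le[OF l(1,2)] by (rule less_le_trans)
      ultimately show ?thesis using False by (simp add: log_divide algebra_simps)
    qed simp
  qed
  \<comment> \<open>The entropy formula sums over attained pairs; the pairs added here have empty
    cells.\<close>
  also have "\<dots> = (\<Sum>(r, y)\<in>{..card S} \<times> ?Y ` ?I. ?c y r * log 2 (?t y / ?c y r))"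
  proof (rule sum.mono_neutral_left)
    show "\<forall>i\<in>{..card S} \<times> ?Y ` ?I - (\<lambda>q. (?X q, ?Y q)) ` ?I.
        (case i of (r, y) \<Rightarrow> ?c y r * log 2 (?t y / ?c y r)) = 0"
    proof safe
      fix r q assume "(r, ?Y q) \<notin> (\<lambda>q. (?X q, ?Y q)) ` ?I"
      then have "answer_cell S M l (?Y q) r = {}"
        by (auto simp: answer_cell_def transcript_cell_def image_iff)
      then show "?c (?Y q) r * log 2 (?t (?Y q) / ?c (?Y q) r) = 0" by simp
    qed
  qed (auto simp: finite_transcripts[OF l(3)] key_rank_le_card[OF finite_keys])
  also have "\<dots> = (\<Sum>y\<in>?Y ` ?I. \<Sum>r\<le>card S. ?c y r * log 2 (?t y / ?c y r))"
    by (subst sum.swap) (simp add: sum.cartesian_product)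
  finally show ?thesis .
qed

lemma finite_cells: "configuration S M ls \<Longrightarrow> finite (cells S M ls)"
  by (auto simp: cells_def finite_transcripts configurationD(5))

text \<open>Log ratios and Kraft logarithms alike split into a term \<open>u\<close> of the leaf and
  a term \<open>v\<close> of the cell. Since the cell masses of a leaf add up to its mass, the two
  terms can be treated by \<open>gibbs\<close> separately.\<close>

lemma sum_cells:
  assumes ls: "configuration S M ls"
  shows "(\<Sum>(l, y, r)\<in>cells S M ls. measure \<mu> (answer_cell S M l y r) * (u l + v l y r)) =
    (\<Sum>l\<in>set ls. measure \<mu> (interval l) * u l) +
    (\<Sum>l\<in>set ls. \<Sum>y\<in>transcript S M l ` interval l. \<Sum>r\<le>card S.
      measure \<mu> (answer_cell S M l y r) * v l y r)"
proof -
  have "(\<Sum>(l, y, r)\<in>cells S M ls. measure \<mu> (answer_cell S M l y r) * (u l + v l y r)) =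
    (\<Sum>l\<in>set ls. \<Sum>y\<in>transcript S M l ` interval l. \<Sum>r\<le>card S.
      measure \<mu> (answer_cell S M l y r) * (u l + v l y r))"
    unfolding cells_def sum.cartesian_product
    by (rule sum.Sigma[symmetric])
      (auto intro!: finite_cartesian_product finite_transcripts configurationD(5)[OF ls])
  also have "\<dots> = (\<Sum>l\<in>set ls. measure \<mu> (interval l) * u l +
    (\<Sum>y\<in>transcript S M l ` interval l. \<Sum>r\<le>card S. measure \<mu> (answer_cell S M l y r) * v l y r))"
  proof (rule sum.cong)
    fix l assume "l \<in> set ls"
    note l = configurationD(3,4,5)[OF ls this]
    show "(\<Sum>y\<in>transcript S M l ` interval l. \<Sum>r\<le>card S.
        measure \<mu> (answer_cell S M l y r) * (u l + v l y r)) = measure \<mu> (interval l) * u l +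
      (\<Sum>y\<in>transcript S M l ` interval l. \<Sum>r\<le>card S. measure \<mu> (answer_cell S M l y r) * v l y r)"
      using sum_measure_transcript_cells[OF l]
      by (simp add: distrib_left sum.distrib sum_measure_answer_cells[OF l(1,2)]
        flip: sum_distrib_right)
  qed simp
  finally show ?thesis by (simp add: sum.distrib)
qed

lemma residual_cost_eq:
  assumes ls: "configuration S M ls"
  shows "residual_cost S \<mu> M ls = (\<Sum>(l, y, r)\<in>cells S M ls. measure \<mu> (answer_cell S M l y r) *
    (log 2 (1 / measure \<mu> (interval l)) +
     log 2 (measure \<mu> (transcript_cell S M l y) / measure \<mu> (answer_cell S M l y r))))"
  unfolding sum_cells[OF ls] residual_cost_def partition_entropy_def map_map comp_def
    sum_list_distinct_conv_sum_set[OF configuration_distinct[OF ls]]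
  using repair_entropy_eq[OF configurationD(3,4,5)[OF ls]]
  by (intro arg_cong2[of _ _ _ _ "(+)"] sum.cong refl) auto

lemma residual_cost_nonneg:
  assumes ls: "configuration S M ls"
  shows "0 \<le> residual_cost S \<mu> M ls"
  unfolding residual_cost_eq[OF ls]
proof (rule sum_nonneg, clarify)
  fix l y r assume "(l, y, r) \<in> cells S M ls"
  then have "l \<in> set ls" by (auto simp: cells_def)
  note l = configurationD(3,4)[OF ls this]
  let ?c = "measure \<mu> (answer_cell S M l y r)"
  have "0 \<le> log 2 (1 / measure \<mu> (interval l))"
    by (simp add: log_inverse_nonneg)
  moreover have "0 \<le> log 2 (measure \<mu> (transcript_cell S M l y) / ?c)" if "?c \<noteq> 0"
    using that measure_answer_cell_le[OF l, of y r]
    by (intro log_ratio_nonneg) (simp_all add: zero_less_measure_iff)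
  ultimately show "0 \<le> ?c * (log 2 (1 / measure \<mu> (interval l)) +
     log 2 (measure \<mu> (transcript_cell S M l y) / ?c))"
    by (cases "?c = 0") auto
qed

section \<open>Expectations bounded by sums over cells\<close>

lemma nn_integral_simple_sum:
  assumes "finite Z" "\<And>z. z \<in> Z \<Longrightarrow> E z \<in> sets \<mu>" "\<And>z. z \<in> Z \<Longrightarrow> 0 \<le> c z"
  shows "(\<integral>\<^sup>+ q. (\<Sum>z\<in>Z. ennreal (c z) * indicator (E z) q) \<partial>\<mu>) = ennreal (\<Sum>z\<in>Z. measure \<mu> (E z) * c z)"
proof -
  have "(\<integral>\<^sup>+ q. (\<Sum>z\<in>Z. ennreal (c z) * indicator (E z) q) \<partial>\<mu>) =
      (\<Sum>z\<in>Z. ennreal (c z) * emeasure \<mu> (E z))"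
    using assms by (subst nn_integral_sum) (auto simp: nn_integral_cmult_indicator)
  also have "\<dots> = (\<Sum>z\<in>Z. ennreal (measure \<mu> (E z) * c z))"
    using assms by (intro sum.cong) (simp_all add: emeasure_eq_measure ennreal_mult mult.commute)
  also have "\<dots> = ennreal (\<Sum>z\<in>Z. measure \<mu> (E z) * c z)"
    using assms by (intro sum_ennreal) auto
  finally show ?thesis .
qed

lemma sum_indicator_disjoint:
  assumes "finite Z" "disjoint_family_on E Z" "z \<in> Z" "q \<in> E z"
  shows "(\<Sum>z\<in>Z. ennreal (c z) * indicator (E z) q) = ennreal (c z)"
proof -
  have "(\<Sum>z\<in>Z. ennreal (c z) * indicator (E z) q) = (\<Sum>z'\<in>{z}. ennreal (c z') * indicator (E z') q)"
  proof (rule sum.mono_neutral_right)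
    have "q \<notin> E z'" if "z' \<in> Z - {z}" for z'
      using disjoint_family_onD[OF assms(2), of z' z] that assms(3,4) by auto
    then show "\<forall>z'\<in>Z - {z}. ennreal (c z') * indicator (E z') q = 0" by simp
  qed (use assms in auto)
  then show ?thesis using assms by simp
qed

text \<open>\<open>query_cost\<close> need not be measurable, as \<open>eval_cost\<close> is merely
  bounded. The integral is therefore compared with that of a simple function by monotonicity
  alone.\<close>

lemma nn_integral_ge_simple:
  assumes Z: "finite Z" "disjoint_family_on E Z" "\<And>z. z \<in> Z \<Longrightarrow> E z \<in> sets \<mu>" "\<And>z. z \<in> Z \<Longrightarrow> 0 \<le> c z"
    and g: "\<And>z q. z \<in> Z \<Longrightarrow> q \<in> E z \<Longrightarrow> c z \<le> g q"
  shows "ennreal (\<Sum>z\<in>Z. measure \<mu> (E z) * c z) \<le> (\<integral>\<^sup>+ q. ennreal (g q) \<partial>\<mu>)"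
proof (subst nn_integral_simple_sum[symmetric, where E = E and c = c and Z = Z])
  show "(\<integral>\<^sup>+ q. (\<Sum>z\<in>Z. ennreal (c z) * indicator (E z) q) \<partial>\<mu>) \<le> (\<integral>\<^sup>+ q. ennreal (g q) \<partial>\<mu>)"
  proof (rule nn_integral_mono)
    fix q
    show "(\<Sum>z\<in>Z. ennreal (c z) * indicator (E z) q) \<le> ennreal (g q)"
    proof (cases "\<exists>z\<in>Z. q \<in> E z")
      case True
      then obtain z where z: "z \<in> Z" "q \<in> E z" by blast
      show ?thesis
        using sum_indicator_disjoint[OF Z(1,2) z] g[OF z] by (simp add: ennreal_leI)
    qed (simp add: sum.neutral)
  qed
qed (use Z in auto)

text \<open>The bound on \<open>g\<close> is asked for on sets of positive mass only, because the
  balanced trees promise no depth for items of weight zero. The finitely many null sets are avoided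
  almost everywhere.\<close>

lemma nn_integral_le_simple:
  assumes Z: "finite Z" "disjoint_family_on E Z" "\<And>z. z \<in> Z \<Longrightarrow> E z \<in> sets \<mu>" "\<And>z. z \<in> Z \<Longrightarrow> 0 \<le> c z"
    and cover: "(\<Union>z\<in>Z. E z) = UNIV"
    and g: "\<And>z q. z \<in> Z \<Longrightarrow> 0 < measure \<mu> (E z) \<Longrightarrow> q \<in> E z \<Longrightarrow> g q \<le> c z"
  shows "(\<integral>\<^sup>+ q. ennreal (g q) \<partial>\<mu>) \<le> ennreal (\<Sum>z\<in>Z. measure \<mu> (E z) * c z)"
proof (subst nn_integral_simple_sum[symmetric, where E = E and c = c and Z = Z])
  show "(\<integral>\<^sup>+ q. ennreal (g q) \<partial>\<mu>) \<le> (\<integral>\<^sup>+ q. (\<Sum>z\<in>Z. ennreal (c z) * indicator (E z) q) \<partial>\<mu>)"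
  proof (rule nn_integral_mono_AE)
    have "AE q in \<mu>. \<forall>z\<in>Z. measure \<mu> (E z) = 0 \<longrightarrow> q \<notin> E z"
      using Z(1)
    proof (rule AE_finite_allI)
      fix z assume z: "z \<in> Z"
      show "AE q in \<mu>. measure \<mu> (E z) = 0 \<longrightarrow> q \<notin> E z"
        using z Z(3) by (cases "measure \<mu> (E z) = 0") (auto intro!: AE_not_in simp: null_sets_def emeasure_eq_measure)
    qed
    then show "AE q in \<mu>. ennreal (g q) \<le> (\<Sum>z\<in>Z. ennreal (c z) * indicator (E z) q)"
    proof (eventually_elim)
      fix q assume null: "\<forall>z\<in>Z. measure \<mu> (E z) = 0 \<longrightarrow> q \<notin> E z"
      obtain z where z: "z \<in> Z" "q \<in> E z" using cover by blast
      then have "0 < measure \<mu> (E z)" using null by (auto simp: zero_less_measure_iff)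
      then show "ennreal (g q) \<le> (\<Sum>z\<in>Z. ennreal (c z) * indicator (E z) q)"
        using sum_indicator_disjoint[OF Z(1,2) z] g[OF z(1) _ z(2)] by (simp add: ennreal_leI)
    qed
  qed
qed (use Z in auto)

lemma cells_partition:
  assumes ls: "configuration S M ls"
  shows "disjoint_family_on (\<lambda>(l, y, r). answer_cell S M l y r) (cells S M ls)"
    and "(\<Union>(l, y, r)\<in>cells S M ls. answer_cell S M l y r) = UNIV"
    and "\<And>l y r. (l, y, r) \<in> cells S M ls \<Longrightarrow> answer_cell S M l y r \<in> sets \<mu>"
proof -
  show "disjoint_family_on (\<lambda>(l, y, r). answer_cell S M l y r) (cells S M ls)"
    unfolding disjoint_family_on_def
  proof (intro ballI impI, rule ccontr)
    fix z z' assume z: "z \<in> cells S M ls" "z' \<in> cells S M ls" "z \<noteq> z'"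
      and meet: "(case z of (l, y, r) \<Rightarrow> answer_cell S M l y r) \<inter>
        (case z' of (l, y, r) \<Rightarrow> answer_cell S M l y r) \<noteq> {}"
    obtain l y r l' y' r' where eq: "z = (l, y, r)" "z' = (l', y', r')"
      by (metis prod_cases3)
    obtain q where q: "q \<in> answer_cell S M l y r" "q \<in> answer_cell S M l' y' r'"
      using meet by (auto simp: eq)
    then have "l = l'"
      using configuration_disjoint[OF ls, of l l' q] z(1,2)
      by (simp add: eq cells_def answer_cell_def transcript_cell_def)
    then show False using q z(3) by (simp add: eq answer_cell_def transcript_cell_def)
  qed
  have "q \<in> (\<Union>(l, y, r)\<in>cells S M ls. answer_cell S M l y r)" for q
  proof -
    obtain l where l: "l \<in> set ls" "q \<in> interval l"
      using configurationD(1)[OF ls] by blast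
    then have "(l, transcript S M l q, key_rank S q) \<in> cells S M ls"
      by (auto simp: cells_def key_rank_le_card[OF finite_keys])
    moreover have "q \<in> answer_cell S M l (transcript S M l q) (key_rank S q)"
      using l by (simp add: answer_cell_def transcript_cell_def)
    ultimately show ?thesis by blast
  qed
  then show "(\<Union>(l, y, r)\<in>cells S M ls. answer_cell S M l y r) = UNIV" by blast
  show "answer_cell S M l y r \<in> sets \<mu>" if "(l, y, r) \<in> cells S M ls" for l y r
    using that configurationD(3,4)[OF ls] by (intro sets_answer_cell) (auto simp: cells_def)
qed

end

subsection \<open>Repair trees and routed indexes\<close>

text \<open>The items are the ranks occurring in the transcript cell. The weights \<open>p\<close>
  are left arbitrary so that a refined leaf can be served with the cell masses of the original
  leaf.\<close>

lemma ex_repair_tree: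
  fixes p :: "nat \<Rightarrow> real"
  assumes S: "finite S" and l: "certified S M l" and p: "\<And>r. 0 \<le> p r"
  shows "\<exists>t. \<forall>q\<in>transcript_cell S M l y.
    keys t \<subseteq> {x \<in> S. key_rank S x \<in> tr_window y} \<and> run t q = key_rank S q \<and>
    (0 < p (key_rank S q) \<longrightarrow>
      real (comparisons t q) \<le> 2 * log 2 ((\<Sum>r\<le>card S. p r) / p (key_rank S q)) + 2)"
proof (cases "transcript_cell S M l y = {}")
  case nonempty: False
  let ?A = "key_rank S ` transcript_cell S M l y"
  let ?as = "sorted_list_of_set ?A"
  let ?X = "\<lambda>r. answer_cell S M l y r"
  let ?K = "{x \<in> S. key_rank S x \<in> tr_window y}"
  have A: "finite ?A" "?A \<noteq> {}" using finite_key_rank[OF S] nonempty by auto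
  have "separable ?K ?X ?as"
    unfolding separable_def
  proof (intro allI impI, elim conjE)
    fix us vs assume as: "?as = us @ vs" "us \<noteq> []" "vs \<noteq> []"
    then obtain r vs' where vs: "vs = r # vs'" by (cases vs) auto
    have sorted: "sorted (us @ r # vs')" "distinct (us @ r # vs')" and set: "set (us @ r # vs') = ?A"
      using A as(1) by (simp_all flip: as(1) vs)
    have less: "u < r" if "u \<in> set us" for u
      using sorted that by (auto simp: sorted_append less_le)
    obtain q0 where q0: "q0 \<in> transcript_cell S M l y" "r = key_rank S q0"
      using set by auto
    \<comment> \<open>A smaller rank occurs before the cut, so \<open>r\<close> is positive and
      \<open>q0\<close> has a predecessor.\<close>
    obtain u where "u \<in> set us" using as(2) by (cases us) auto
    then have "0 < key_rank S q0" using less q0(2) by (metis gr_implies_not0 neq0_conv)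
    then have pred: "{x \<in> S. x \<le> q0} \<noteq> {}" by (metis card.empty key_rank_def less_irrefl)
    \<comment> \<open>The predecessor \<open>k\<close> of a query of rank \<open>r\<close> has rank
      \<open>r\<close> itself, and \<open>q < k\<close> holds exactly for queries of smaller rank,
      so \<open>Lt k\<close> makes the cut. As \<open>r\<close> occurs in the cell, it lies in the
      window, and \<open>k\<close> is an admissible key.\<close>
    define k where "k = Max {x \<in> S. x \<le> q0}"
    have k: "k \<in> S" "k \<le> q0" "\<And>x. x \<in> S \<Longrightarrow> x \<le> q0 \<Longrightarrow> x \<le> k"
      using Max_in[OF _ pred] S by (auto simp: k_def)
    have "{x \<in> S. x \<le> k} = {x \<in> S. x \<le> q0}"
      using k by (auto intro: order_trans)
    then have rank_k: "key_rank S k = r" by (simp add: key_rank_def q0(2))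
    have key_less: "q < k \<longleftrightarrow> key_rank S q < r" for q
    proof
      assume "q < k"
      then have "k \<in> {x \<in> S. x \<le> k} - {x \<in> S. x \<le> q}" "{x \<in> S. x \<le> q} \<subseteq> {x \<in> S. x \<le> k}"
        using k(1) by auto
      then have "{x \<in> S. x \<le> q} \<subset> {x \<in> S. x \<le> k}" by blast
      then show "key_rank S q < r"
        unfolding rank_k[symmetric] key_rank_def using S by (intro psubset_card_mono) auto
    next
      assume "key_rank S q < r"
      then show "q < k"
        using key_rank_mono[OF S, of k q] rank_k by (metis not_le)
    qed
    have "r \<in> tr_window y"
      using key_rank_in_window[OF S l, of q0] q0 by (auto simp: transcript_cell_def transcript_def)
    moreover have "holds (Lt k) q" if "u \<in> set us" "q \<in> ?X u" for u q
      using that less by (simp add: key_less answer_cell_def)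
    moreover have "\<not> holds (Lt k) q" if "v \<in> set vs" "q \<in> ?X v" for v q
      using that sorted(1) by (auto simp: key_less answer_cell_def vs sorted_append)
    ultimately show "\<exists>c. key c \<in> ?K \<and> (\<forall>u\<in>set us. \<forall>q\<in>?X u. holds c q) \<and>
        (\<forall>v\<in>set vs. \<forall>q\<in>?X v. \<not> holds c q)"
      using k(1) rank_k by (intro exI[of _ "Lt k"]) auto
  qed
  then obtain t where t: "keys t \<subseteq> ?K" and run: "\<forall>r\<in>set ?as. \<forall>q\<in>?X r. run t q = r \<and>
      (0 < p r \<longrightarrow> real (comparisons t q) \<le> 2 * log 2 ((\<Sum>r\<leftarrow>?as. p r) / p r) + 2)"
    using alphabetic_tree[where w = p and g = "\<lambda>r. r", of ?as ?K ?X] p A by auto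
  have W: "(\<Sum>r\<leftarrow>?as. p r) \<le> (\<Sum>r\<le>card S. p r)"
    using A(1) p key_rank_le_card[OF S]
    by (auto simp: sum_list_distinct_conv_sum_set intro!: sum_mono2)
  show ?thesis
  proof (intro exI[of _ t] ballI conjI impI)
    fix q assume q: "q \<in> transcript_cell S M l y"
    then have q': "key_rank S q \<in> set ?as" "q \<in> ?X (key_rank S q)"
      using A by (auto simp: answer_cell_def)
    show "keys t \<subseteq> ?K" using t .
    show "run t q = key_rank S q" using run q' by blast
    assume pos: "0 < p (key_rank S q)"
    have "p (key_rank S q) \<le> (\<Sum>r\<leftarrow>?as. p r)"
      using member_le_sum_list[of "p (key_rank S q)" "map p ?as"] q'(1) p by auto
    then have "log 2 ((\<Sum>r\<leftarrow>?as. p r) / p (key_rank S q)) \<le>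
        log 2 ((\<Sum>r\<le>card S. p r) / p (key_rank S q))"
      using W pos by (intro log_mono) (auto intro: divide_right_mono)
    then show "real (comparisons t q) \<le> 2 * log 2 ((\<Sum>r\<le>card S. p r) / p (key_rank S q)) + 2"
      using run q' pos by fastforce
  qed
qed simp

text \<open>A trimmed leaf keeps its predictor and radius, except that the empty predictor is
  certified with exactly the rank diameter, which depends on the interval.\<close>

fun refined_leaf :: "'u::linorder set \<Rightarrow> 'u set \<times> 'u leaf option \<times> real \<Rightarrow> 'u leaf" where
  "refined_leaf S (X, None, w) = \<lparr>interval = X, atoms = 0, model = [], radius = rank_diameter S X\<rparr>"
| "refined_leaf S (X, Some l, w) =
    l\<lparr>interval := X, radius := if model l = [] then rank_diameter S X else radius l\<rparr>"

lemma interval_refined_leaf [simp]: "interval (refined_leaf S z) = fst z"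
  by (cases "(S, z)" rule: refined_leaf.cases) auto

lemma atom_count_refined_leaf:
  "atom_count (map (refined_leaf S) zs) = atom_count (List.map_filter (fst \<circ> snd) zs)"
proof (induction zs)
  case (Cons z zs)
  then show ?case
    by (cases "(S, z)" rule: refined_leaf.cases) (auto simp: atom_count_def List.map_filter_simps)
qed (simp add: atom_count_def List.map_filter_simps)

context learning_problem
begin

lemma sum_measure_intervals:
  assumes ls: "configuration S M ls"
  shows "(\<Sum>l\<in>set ls. measure \<mu> (interval l)) = 1"
proof -
  have "disjoint_family_on interval (set ls)"
    using configuration_disjoint[OF ls] by (auto simp: disjoint_family_on_def)
  then have "(\<Sum>l\<in>set ls. measure \<mu> (interval l)) = measure \<mu> (\<Union>l\<in>set ls. interval l)"
    using configurationD(3)[OF ls] sets_order_convex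
    by (intro finite_measure_finite_Union[symmetric]) auto
  then show ?thesis
    using configurationD(1)[OF ls] prob_space by simp
qed

lemma sum_measure_cells:
  assumes ls: "configuration S M ls"
  shows "(\<Sum>(l, y, r)\<in>cells S M ls. measure \<mu> (answer_cell S M l y r)) = 1"
  using sum_cells[OF ls, of "\<lambda>_. 1" "\<lambda>_ _ _. 0"] sum_measure_intervals[OF ls] by simp

section \<open>Lower bound: residual cost against expected comparisons\<close>

lemma residual_cost_le_expected_cost:
  assumes D: "routed_index S M D"
  shows "ennreal (residual_cost S \<mu> M (leaves (directory D))) \<le> expected_cost S \<mu> M D"
proof -
  let ?ls = "leaves (directory D)"
  let ?m = "\<lambda>l y r. measure \<mu> (answer_cell S M l y r)"
  let ?u = "\<lambda>l. log 2 (1 / kraft (directory D) l)"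
  let ?v = "\<lambda>y r. log 2 (1 / kraft (repair D y) r)"
  have ls: "configuration S M ?ls" using D by (simp add: routed_index_def)
  have route: "run (directory D) q = l" if "l \<in> set ?ls" "q \<in> interval l" for l q
    using configuration_disjoint[OF ls run_in_leaves that(1) _ that(2)] D
    by (simp add: routed_index_def)
  have rep: "run (repair D (transcript S M l q)) q = key_rank S q" if "l \<in> set ?ls" "q \<in> interval l" for l q
  proof -
    have "run (repair D (index_transcript S M D q)) q = key_rank S q"
      using D by (simp add: routed_index_def Let_def)
    then show ?thesis by (simp add: index_transcript_def route[OF that])
  qed
  have "residual_cost S \<mu> M ?ls = (\<Sum>l\<in>set ?ls. measure \<mu> (interval l) * log 2 (1 / measure \<mu> (interval l))) +
    (\<Sum>l\<in>set ?ls. \<Sum>y\<in>transcript S M l ` interval l. \<Sum>r\<le>card S.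
      ?m l y r * log 2 (measure \<mu> (transcript_cell S M l y) / ?m l y r))"
    unfolding residual_cost_eq[OF ls] sum_cells[OF ls] ..
  also have "\<dots> \<le> (\<Sum>l\<in>set ?ls. measure \<mu> (interval l) * ?u l) +
    (\<Sum>l\<in>set ?ls. \<Sum>y\<in>transcript S M l ` interval l. \<Sum>r\<le>card S. ?m l y r * ?v y r)"
  proof (rule add_mono)
    show "(\<Sum>l\<in>set ?ls. measure \<mu> (interval l) * log 2 (1 / measure \<mu> (interval l))) \<le>
        (\<Sum>l\<in>set ?ls. measure \<mu> (interval l) * ?u l)"
    proof (rule gibbs)
      fix l assume l: "l \<in> set ?ls"
      then obtain q where "q \<in> interval l" using configurationD(2)[OF ls] by blast
      then show "0 < kraft (directory D) l"
        using kraft_run_pos[of "directory D" q] route[OF l] by simp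
    qed (simp_all add: kraft_nonneg sum_kraft_le_1 sum_measure_intervals[OF ls])
  next
    show "(\<Sum>l\<in>set ?ls. \<Sum>y\<in>transcript S M l ` interval l. \<Sum>r\<le>card S.
        ?m l y r * log 2 (measure \<mu> (transcript_cell S M l y) / ?m l y r)) \<le>
      (\<Sum>l\<in>set ?ls. \<Sum>y\<in>transcript S M l ` interval l. \<Sum>r\<le>card S. ?m l y r * ?v y r)"
    proof (rule sum_mono, rule sum_mono, rule gibbs)
      \<comment> \<open>Positive mass provides a query in the cell. By correctness its repair ends
        at a tip labelled \<open>r\<close>, so the Kraft sum is positive.\<close>
      fix l y r assume l: "l \<in> set ?ls" and "0 < ?m l y r"
      then have "answer_cell S M l y r \<noteq> {}" by force
      then obtain q where "q \<in> answer_cell S M l y r" by blast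
      then show "0 < kraft (repair D y) r"
        using kraft_run_pos[of "repair D y" q] rep[OF l, of q]
        by (auto simp: answer_cell_def transcript_cell_def)
    qed (simp_all add: kraft_nonneg sum_kraft_le_1 sum_measure_answer_cells[OF configurationD(3,4)[OF ls]])
  qed
  also have "\<dots> = (\<Sum>(l, y, r)\<in>cells S M ?ls. ?m l y r * (?u l + ?v y r))"
    unfolding sum_cells[OF ls] ..
  finally have "ennreal (residual_cost S \<mu> M ?ls) \<le>
      ennreal (\<Sum>z\<in>cells S M ?ls. measure \<mu> (case z of (l, y, r) \<Rightarrow> answer_cell S M l y r) *
        (case z of (l, y, r) \<Rightarrow> ?u l + ?v y r))"
    by (simp add: split_def ennreal_leI)
  also have "\<dots> \<le> (\<integral>\<^sup>+ q. ennreal (query_cost S M D q) \<partial>\<mu>)"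
  proof (rule nn_integral_ge_simple[OF finite_cells[OF ls] cells_partition(1)[OF ls]])
    fix z q assume z: "z \<in> cells S M ?ls" and q: "q \<in> (case z of (l, y, r) \<Rightarrow> answer_cell S M l y r)"
    obtain l y r where z': "z = (l, y, r)" by (cases z)
    have l: "l \<in> set ?ls" "q \<in> interval l" and y: "y = transcript S M l q" and r: "r = key_rank S q"
      using z q by (auto simp: z' cells_def answer_cell_def transcript_cell_def)
    \<comment> \<open>The evaluation cost is simply dropped from the lower bound.\<close>
    have "0 \<le> eval_cost M (model l) q"
      using family configurationD(4)[OF ls l(1)] by (auto simp: atomized_family_def)
    then show "(case z of (l, y, r) \<Rightarrow> ?u l + ?v y r) \<le> query_cost S M D q"
      using log_kraft_le_comparisons[of "directory D" q] log_kraft_le_comparisons[of "repair D y" q]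
      by (simp add: z' query_cost_def index_transcript_def route[OF l] y r rep[OF l])
  qed (use cells_partition(3)[OF ls] in \<open>auto intro!: add_nonneg_nonneg log_inverse_nonneg kraft_nonneg kraft_le_1\<close>)
  finally show ?thesis by (simp add: expected_cost_def)
qed

lemma RGap_le:
  assumes "configuration S M ls" "atom_count ls \<le> B"
  shows "RGap S \<mu> M B \<le> residual_cost S \<mu> M ls"
  unfolding RGap_def using assms residual_cost_nonneg
  by (intro cInf_lower bdd_belowI[of _ 0]) auto

lemma empty_model: "[] \<in> models M 0"
  using family by (simp add: atomized_family_def)

text \<open>A single leaf with the empty predictor fits every budget. Without a member,
  \<open>Inf\<close> would be an arbitrary real.\<close>

lemma RGap_set_nonempty: "{residual_cost S \<mu> M ls | ls. configuration S M ls \<and> atom_count ls \<le> B} \<noteq> {}"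
proof -
  let ?l = "\<lparr>interval = UNIV, atoms = 0, model = [], radius = rank_diameter S UNIV\<rparr>"
  have "configuration S M [?l]"
    using empty_model
    by (simp add: configuration_def ordered_partition_def order_convex_def certified_def)
  moreover have "atom_count [?l] \<le> B" by (simp add: atom_count_def)
  ultimately show ?thesis by blast
qed

lemma RGap_nonneg: "0 \<le> RGap S \<mu> M B"
  unfolding RGap_def using RGap_set_nonempty residual_cost_nonneg
  by (intro cInf_greatest) auto

lemma ex_near_RGap:
  assumes "0 < \<epsilon>"
  obtains ls where "configuration S M ls" "atom_count ls \<le> B" "residual_cost S \<mu> M ls < RGap S \<mu> M B + \<epsilon>"
  using cInf_lessD[OF RGap_set_nonempty, of B "RGap S \<mu> M B + \<epsilon>"] assms
  by (auto simp: RGap_def)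

section \<open>Upper bound: an index built on the refinement of a configuration\<close>

text \<open>Error bounds and finiteness of ranges are inherited by subintervals, so trimming keeps a
  nonempty predictor certified.\<close>

lemma configuration_refined_leaf:
  assumes ls: "configuration S M ls"
    and zs: "refinement S f (map (\<lambda>l. (interval l, l)) ls) zs"
  shows "configuration S M (map (refined_leaf S) zs)"
proof -
  interpret zs: refinement S f "map (\<lambda>l. (interval l, l)) ls" zs by (rule zs)
  have "\<Union>(fst ` set zs) = UNIV"
    using zs.union configurationD(1)[OF ls] by (simp add: image_image)
  then have "ordered_partition (map interval (map (refined_leaf S) zs))"
    using zs.consecutive by (auto simp: ordered_partition_def consecutive_def sorted_wrt_map comp_def)
  moreover have "model (refined_leaf S z) \<in> models M (atoms (refined_leaf S z)) \<and>
      certified S M (refined_leaf S z)" if z: "z \<in> set zs" for z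
  proof -
    obtain X s w where z': "z = (X, s, w)" by (cases z)
    show ?thesis
    proof (cases s)
      case None
      then show ?thesis using empty_model by (simp add: z' certified_def)
    next
      case (Some l)
      then have l: "l \<in> set ls" "X \<subseteq> interval l"
        using zs.subpart[of X l w] z by (auto simp: z')
      then show ?thesis
        using configurationD(4,5)[OF ls l(1)]
        by (auto simp: z' Some certified_def intro: finite_subset[OF image_mono[OF l(2)]])
    qed
  qed
  ultimately show ?thesis by (auto simp: configuration_def)
qed

text \<open>The repair trees are balanced with respect to the cells of the configuration itself rather
  than those of its refinement, so that the cost can be compared query by query.\<close>

lemma ex_repair_tree_refined:
  assumes ls: "configuration S M ls"
    and zs: "refinement S f (map (\<lambda>l. (interval l, l)) ls) zs" and z: "z \<in> set zs"
  shows "\<exists>t. \<forall>q\<in>transcript_cell S M (refined_leaf S z) y.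
    keys t \<subseteq> {x \<in> S. key_rank S x \<in> tr_window y} \<and> run t q = key_rank S q \<and>
    (\<forall>l\<in>set ls. q \<in> interval l \<longrightarrow>
      0 < measure \<mu> (answer_cell S M l (transcript S M l q) (key_rank S q)) \<longrightarrow>
      real (comparisons t q) \<le> 2 * log 2 (measure \<mu> (transcript_cell S M l (transcript S M l q)) /
        measure \<mu> (answer_cell S M l (transcript S M l q) (key_rank S q))) + 2)"
proof (cases "transcript_cell S M (refined_leaf S z) y = {}")
  case False
  interpret zs: refinement S f "map (\<lambda>l. (interval l, l)) ls" zs by (rule zs)
  let ?l' = "refined_leaf S z"
  obtain q0 where q0: "q0 \<in> fst z" "transcript S M ?l' q0 = y"
    using False by (auto simp: transcript_cell_def)
  have cert: "certified S M ?l'"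
    using configurationD(5)[OF configuration_refined_leaf[OF ls zs]] z by simp
  obtain X s w where z': "z = (X, s, w)" by (cases z)
  show ?thesis
  proof (cases s)
    case None
    have const: "key_rank S q = key_rank S q0" if "q \<in> transcript_cell S M ?l' y" for q
      using zs.rank_constant[of X w q q0] z q0 that by (simp add: z' None transcript_cell_def)
    \<comment> \<open>A gap part has a single rank. Putting weight 1 on it makes the logarithm
      vanish, which leaves at most 2 comparisons.\<close>
    have nonneg: "0 \<le> (of_bool (r = key_rank S q0) :: real)" for r by simp
    from ex_repair_tree[where p = "\<lambda>r. of_bool (r = key_rank S q0)", OF finite_keys cert nonneg, of y]
    obtain t where t: "\<forall>q\<in>transcript_cell S M ?l' y.
      keys t \<subseteq> {x \<in> S. key_rank S x \<in> tr_window y} \<and> run t q = key_rank S q \<and>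
      (0 < (of_bool (key_rank S q = key_rank S q0) :: real) \<longrightarrow>
        real (comparisons t q) \<le> 2 * log 2 ((\<Sum>r\<le>card S. of_bool (r = key_rank S q0)) /
          of_bool (key_rank S q = key_rank S q0)) + 2)"
      by blast
    have sum1: "(\<Sum>r\<le>card S. of_bool (r = key_rank S q0)) = (1 :: real)"
      using key_rank_le_card[OF finite_keys, of q0] by (simp add: of_bool_def)
    show ?thesis
    proof (intro exI[of _ t] ballI conjI impI)
      fix q l assume q: "q \<in> transcript_cell S M ?l' y" and l: "l \<in> set ls"
        and pos: "0 < measure \<mu> (answer_cell S M l (transcript S M l q) (key_rank S q))"
      have "real (comparisons t q) \<le> 2"
        using t q const[OF q] by (simp add: sum1)
      moreover have "0 \<le> log 2 (measure \<mu> (transcript_cell S M l (transcript S M l q)) /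
          measure \<mu> (answer_cell S M l (transcript S M l q) (key_rank S q)))"
        using pos measure_answer_cell_le[OF configurationD(3,4)[OF ls l]] by (rule log_ratio_nonneg)
      ultimately show "real (comparisons t q) \<le>
        2 * log 2 (measure \<mu> (transcript_cell S M l (transcript S M l q)) /
          measure \<mu> (answer_cell S M l (transcript S M l q) (key_rank S q))) + 2"
        by simp
    qed (use t in auto)
  next
    case (Some l)
    then have l: "l \<in> set ls" "X \<subseteq> interval l"
      using zs.subpart[of X l w] z by (auto simp: z')
    let ?y = "transcript S M l q0"
    \<comment> \<open>Trimming changes the recorded interval and possibly the window, but not which
      queries have equal transcripts. So all queries of the cell share the transcript
      \<open>?y\<close> at the original leaf.\<close>
    have same: "transcript S M l q = ?y" if "q \<in> transcript_cell S M ?l' y" for q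
      using that q0 by (auto simp: z' Some transcript_cell_def transcript_eq_iff)
    obtain t where t: "\<forall>q\<in>transcript_cell S M ?l' y.
      keys t \<subseteq> {x \<in> S. key_rank S x \<in> tr_window y} \<and> run t q = key_rank S q \<and>
      (0 < measure \<mu> (answer_cell S M l ?y (key_rank S q)) \<longrightarrow>
        real (comparisons t q) \<le> 2 * log 2 ((\<Sum>r\<le>card S. measure \<mu> (answer_cell S M l ?y r)) /
          measure \<mu> (answer_cell S M l ?y (key_rank S q))) + 2)"
      using ex_repair_tree[OF finite_keys cert, of "\<lambda>r. measure \<mu> (answer_cell S M l ?y r)" y] by auto
    show ?thesis
    proof (intro exI[of _ t] ballI conjI impI)
      fix q l2 assume q: "q \<in> transcript_cell S M ?l' y" and l2: "l2 \<in> set ls" "q \<in> interval l2"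
        and pos: "0 < measure \<mu> (answer_cell S M l2 (transcript S M l2 q) (key_rank S q))"
      have "q \<in> interval l" using q l(2) by (auto simp: z' transcript_cell_def)
      then have "l2 = l" using configuration_disjoint[OF ls l2(1) l(1) l2(2)] by simp
      then show "real (comparisons t q) \<le>
        2 * log 2 (measure \<mu> (transcript_cell S M l2 (transcript S M l2 q)) /
          measure \<mu> (answer_cell S M l2 (transcript S M l2 q) (key_rank S q))) + 2"
        using t[rule_format, OF q] pos same[OF q]
          sum_measure_answer_cells[OF configurationD(3,4)[OF ls l(1)]] by simp
    qed (use t in auto)
  qed
qed simp

lemma ex_routed_index:
  assumes ls: "configuration S M ls" and "0 \<le> \<kappa>"
  shows "\<exists>D. routed_index S M D \<and> index_atoms D = atom_count ls \<and>
    expected_cost S \<mu> M D \<le> ennreal (2 * residual_cost S \<mu> M ls + (8 + \<kappa>))"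
proof -
  let ?p = "\<lambda>l. measure \<mu> (interval l)"
  let ?ps = "map (\<lambda>l. (interval l, l)) ls"
  have ps: "\<Union>(fst ` set ?ps) = UNIV" using configurationD(1)[OF ls] by (simp add: image_image)
  then have "ls \<noteq> []" by auto
  obtain zs where zs: "refinement S ?p ?ps zs"
    using ex_refinement[OF finite_keys, of ?p ?ps] configuration_consecutive[OF ls] ps \<open>ls \<noteq> []\<close>
    by (auto simp: upper_set_def)
  interpret zs: refinement S ?p ?ps zs by (rule zs)
  let ?ls' = "map (refined_leaf S) zs"
  let ?w = "\<lambda>z :: 'u set \<times> 'u leaf option \<times> real. snd (snd z)"
  have ls': "configuration S M ?ls'" using configuration_refined_leaf[OF ls zs] .
  have W: "(\<Sum>z\<leftarrow>zs. ?w z) \<le> 3"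
  proof -
    have "(\<Sum>z\<leftarrow>zs. ?w z) \<le> 3 * (\<Sum>p\<leftarrow>?ps. ?p (snd p))"
      using zs.total_weight measure_nonneg[of \<mu> "interval (snd (hd ?ps))"] by linarith
    also have "\<dots> = 3 * (\<Sum>l\<leftarrow>ls. ?p l)"
      by (simp add: comp_def)
    also have "\<dots> = 3"
      using sum_measure_intervals[OF ls]
      by (simp add: sum_list_distinct_conv_sum_set[OF configuration_distinct[OF ls]])
    finally show ?thesis .
  qed
  obtain t where t: "leaves t = ?ls'" and route: "\<forall>z\<in>set zs. \<forall>q\<in>fst z. run t q = refined_leaf S z \<and>
      (0 < ?w z \<longrightarrow> real (comparisons t q) \<le> 2 * log 2 ((\<Sum>z\<leftarrow>zs. ?w z) / ?w z) + 2)"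
    using alphabetic_tree[where w = ?w and g = "refined_leaf S",
        OF zs.weight_nonneg zs.separable zs.nonempty] by blast
  have disjoint: "z = z'" if "z \<in> set zs" "z' \<in> set zs" "q \<in> fst z" "q \<in> fst z'" for z z' q
    using sorted_intervals_disjoint[of fst zs z z' q] zs.consecutive that by (simp add: consecutive_def)
  let ?c = "\<lambda>q l. measure \<mu> (transcript_cell S M l (transcript S M l q)) /
    measure \<mu> (answer_cell S M l (transcript S M l q) (key_rank S q))"
  let ?P = "\<lambda>z y t. \<forall>q\<in>transcript_cell S M (refined_leaf S z) y.
    keys t \<subseteq> {x \<in> S. key_rank S x \<in> tr_window y} \<and> run t q = key_rank S q \<and>
    (\<forall>l\<in>set ls. q \<in> interval l \<longrightarrow>
      0 < measure \<mu> (answer_cell S M l (transcript S M l q) (key_rank S q)) \<longrightarrow>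
      real (comparisons t q) \<le> 2 * log 2 (?c q l) + 2)"
  define T where "T z y = (SOME t. ?P z y t)" for z y
  have T_ok: "?P z y (T z y)" if "z \<in> set zs" for z y
    unfolding T_def by (rule someI_ex[OF ex_repair_tree_refined[OF ls zs that]])
  note T = bspec[OF T_ok]
  \<comment> \<open>The repair table sees only the transcript. The recorded interval identifies the
    part, because the parts are nonempty and disjoint.\<close>
  define D where "D = \<lparr>directory = t, repair = (\<lambda>y. T (THE z. z \<in> set zs \<and> fst z = tr_leaf y) y)\<rparr>"
  have D: "run (directory D) q = refined_leaf S z"
    "index_transcript S M D q = transcript S M (refined_leaf S z) q"
    "repair D (transcript S M (refined_leaf S z) q) = T z (transcript S M (refined_leaf S z) q)"
    "q \<in> transcript_cell S M (refined_leaf S z) (transcript S M (refined_leaf S z) q)"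
    if z: "z \<in> set zs" "q \<in> fst z" for z q
  proof -
    show "run (directory D) q = refined_leaf S z" using route z by (simp add: D_def)
    then show "index_transcript S M D q = transcript S M (refined_leaf S z) q"
      by (simp add: index_transcript_def)
    have "(THE z'. z' \<in> set zs \<and> fst z' = fst z) = z"
      using z disjoint by (intro the_equality) auto
    then show "repair D (transcript S M (refined_leaf S z) q) = T z (transcript S M (refined_leaf S z) q)"
      by (simp add: D_def transcript_def)
    show "q \<in> transcript_cell S M (refined_leaf S z) (transcript S M (refined_leaf S z) q)"
      using z by (simp add: transcript_cell_def)
  qed
  have cover: "\<exists>z\<in>set zs. q \<in> fst z" for q
  proof -
    have "q \<in> \<Union>(fst ` set zs)" unfolding zs.union ps by simp
    then show ?thesis by (simp only: UN_iff)
  qed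
  have "routed_index S M D"
    unfolding routed_index_def
  proof (intro conjI allI)
    show "configuration S M (leaves (directory D))" using ls' t by (simp add: D_def)
    fix q
    obtain z where z: "z \<in> set zs" "q \<in> fst z" using cover by blast
    show "q \<in> interval (run (directory D) q)" using D(1)[OF z] z by simp
    show "let y = index_transcript S M D q in
        keys (repair D y) \<subseteq> {x \<in> S. key_rank S x \<in> tr_window y} \<and> run (repair D y) q = key_rank S q"
      using T[OF z(1) D(4)[OF z]] by (simp add: Let_def D(2,3)[OF z])
  qed
  moreover have "index_atoms D = atom_count ls"
  proof -
    have "index_atoms D = atom_count (map snd ?ps)"
      by (simp add: index_atoms_def D_def t atom_count_refined_leaf zs.labels)
    then show ?thesis by (simp add: comp_def)
  qed
  moreover have "expected_cost S \<mu> M D \<le> ennreal (2 * residual_cost S \<mu> M ls + (8 + \<kappa>))"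
  proof -
    let ?m = "\<lambda>l y r. measure \<mu> (answer_cell S M l y r)"
    let ?h = "\<lambda>l y r. log 2 (1 / ?p l) + log 2 (measure \<mu> (transcript_cell S M l y) / ?m l y r)"
    have "(\<integral>\<^sup>+ q. ennreal (query_cost S M D q) \<partial>\<mu>) \<le>
      ennreal (\<Sum>z\<in>cells S M ls. measure \<mu> (case z of (l, y, r) \<Rightarrow> answer_cell S M l y r) *
        (case z of (l, y, r) \<Rightarrow> 2 * ?h l y r + (8 + \<kappa>)))"
    proof (rule nn_integral_le_simple[OF finite_cells[OF ls] cells_partition(1)[OF ls]])
      fix x assume x: "x \<in> cells S M ls"
      obtain l y r where x': "x = (l, y, r)" by (cases x)
      then have l: "l \<in> set ls" using x by (simp add: cells_def)
      show "(case x of (l, y, r) \<Rightarrow> answer_cell S M l y r) \<in> sets \<mu>"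
        using cells_partition(3)[OF ls] x by (simp add: x')
      have "0 \<le> log 2 (measure \<mu> (transcript_cell S M l y) / ?m l y r)"
      proof (cases "?m l y r = 0")
        \<comment> \<open>The ratio has the default value \<open>t / 0 = 0\<close>, and its
          logarithm is 0 again.\<close>
        case True
        then show ?thesis by (simp add: log_def)
      next
        case False
        then show ?thesis
          using measure_answer_cell_le[OF configurationD(3,4)[OF ls l], of y r]
          by (intro log_ratio_nonneg) (simp_all add: zero_less_measure_iff)
      qed
      then show "0 \<le> (case x of (l, y, r) \<Rightarrow> 2 * ?h l y r + (8 + \<kappa>))"
        using log_inverse_nonneg[of "?p l"] \<open>0 \<le> \<kappa>\<close> by (simp add: x')
      fix q assume pos: "0 < measure \<mu> (case x of (l, y, r) \<Rightarrow> answer_cell S M l y r)"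
        and "q \<in> (case x of (l, y, r) \<Rightarrow> answer_cell S M l y r)"
      then have q: "q \<in> interval l" "y = transcript S M l q" "r = key_rank S q"
        by (auto simp: x' answer_cell_def transcript_cell_def)
      obtain z where z: "z \<in> set zs" "q \<in> fst z" using cover by blast
      have pl: "0 < ?p l"
      proof -
        have "?m l y r \<le> ?p l"
          using sets_order_convex[OF configurationD(3)[OF ls l]]
          by (intro finite_measure_mono) (auto simp: answer_cell_def transcript_cell_def)
        then show ?thesis using pos by (simp add: x')
      qed
      have wl: "?p l \<le> ?w z"
        using zs.weight[OF z(1), of "(interval l, l)" q] z(2) q(1) l by simp
      have "?w z \<le> (\<Sum>z\<leftarrow>zs. ?w z)"
        using member_le_sum_list[of "?w z" "map ?w zs"] z(1) zs.weight_nonneg by fastforce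
      \<comment> \<open>The weight of the part dominates the mass of the original leaf of
        \<open>q\<close>, even if the part is a gap. The 2 lost here becomes 2 * 2 + 2 = 6 in
        \<open>dir\<close>.\<close>
      then have "log 2 ((\<Sum>z\<leftarrow>zs. ?w z) / ?w z) \<le> 2 + log 2 (1 / ?p l)"
        using log_ratio_le[OF pl wl] W by simp
      moreover have "real (comparisons t q) \<le> 2 * log 2 ((\<Sum>z\<leftarrow>zs. ?w z) / ?w z) + 2"
        using route[rule_format, OF z] less_le_trans[OF pl wl] by blast
      ultimately have dir: "real (comparisons t q) \<le> 2 * log 2 (1 / ?p l) + 6" by linarith
      have "real (comparisons (T z (transcript S M (refined_leaf S z) q)) q) \<le> 2 * log 2 (?c q l) + 2"
        using T[OF z(1) D(4)[OF z]] l q pos by (simp add: x')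
      moreover have "eval_cost M (model (refined_leaf S z)) q \<le> \<kappa>"
        using family configurationD(4)[OF ls', of "refined_leaf S z"] z(1)
        by (auto simp: atomized_family_def)
      ultimately show "query_cost S M D q \<le> (case x of (l, y, r) \<Rightarrow> 2 * ?h l y r + (8 + \<kappa>))"
        using dir by (simp add: query_cost_def D(1,2,3)[OF z] x' q(2,3)) (simp add: D_def)
    qed (use cells_partition(2)[OF ls] in \<open>simp add: split_def\<close>)
    also have "(\<Sum>z\<in>cells S M ls. measure \<mu> (case z of (l, y, r) \<Rightarrow> answer_cell S M l y r) *
        (case z of (l, y, r) \<Rightarrow> 2 * ?h l y r + (8 + \<kappa>))) =
      2 * (\<Sum>(l, y, r)\<in>cells S M ls. ?m l y r * ?h l y r) +
      (8 + \<kappa>) * (\<Sum>(l, y, r)\<in>cells S M ls. ?m l y r)"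
      unfolding sum_distrib_left sum.distrib[symmetric]
      by (rule sum.cong) (auto simp: algebra_simps)
    finally show ?thesis
      unfolding expected_cost_def residual_cost_eq[OF ls] sum_measure_cells[OF ls] by simp
  qed
  ultimately show ?thesis by blast
qed

lemma RGap_le_expected_cost:
  assumes "routed_index S M D" "index_atoms D \<le> B"
  shows "ennreal (RGap S \<mu> M B) \<le> expected_cost S \<mu> M D"
proof -
  have "RGap S \<mu> M B \<le> residual_cost S \<mu> M (leaves (directory D))"
    using assms by (intro RGap_le) (auto simp: routed_index_def index_atoms_def)
  then show ?thesis
    using residual_cost_le_expected_cost[OF assms(1)] by (meson ennreal_leI order_trans)
qed

lemma ex_near_optimal_index:
  assumes "0 \<le> \<kappa>" "0 < \<eta>"
  shows "\<exists>D. routed_index S M D \<and> index_atoms D \<le> B \<and>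
    expected_cost S \<mu> M D \<le> ennreal ((8 + \<kappa>) * (RGap S \<mu> M B + 1) + \<eta>)"
proof -
  obtain ls where ls: "configuration S M ls" "atom_count ls \<le> B"
    "residual_cost S \<mu> M ls < RGap S \<mu> M B + \<eta> / 2"
    using ex_near_RGap[of "\<eta> / 2"] assms(2) by auto
  obtain D where D: "routed_index S M D" "index_atoms D = atom_count ls"
    "expected_cost S \<mu> M D \<le> ennreal (2 * residual_cost S \<mu> M ls + (8 + \<kappa>))"
    using ex_routed_index[OF ls(1) assms(1)] by blast
  \<comment> \<open>As \<open>RGap\<close> is nonnegative, its factor 2 can be raised to the
    additive constant, which leaves a single constant.\<close>
  have "2 * RGap S \<mu> M B \<le> (8 + \<kappa>) * RGap S \<mu> M B"
    using RGap_nonneg assms(1) by (intro mult_right_mono) auto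
  then have "2 * residual_cost S \<mu> M ls + (8 + \<kappa>) \<le> (8 + \<kappa>) * (RGap S \<mu> M B + 1) + \<eta>"
    using ls(3) by (simp add: distrib_left)
  then have "expected_cost S \<mu> M D \<le> ennreal ((8 + \<kappa>) * (RGap S \<mu> M B + 1) + \<eta>)"
    using D(3) by (meson ennreal_leI order_trans)
  then show ?thesis
    using D(1,2) ls(2) by auto
qed

end

theorem theorem1:
  fixes \<kappa> :: real
  assumes "0 \<le> \<kappa>"
  shows "\<exists>c>0. \<exists>C>0.
    \<forall>(S :: 'u::linorder set) (\<mu> :: 'u measure) (M :: 'u model_family) (B :: nat) (\<beta> :: real).
      finite S \<and> workload \<mu> \<and> atomized_family \<beta> \<kappa> (card S) \<mu> M \<longrightarrow>
        (\<forall>D. routed_index S M D \<and> index_atoms D \<le> B \<longrightarrow>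
           ennreal (c * RGap S \<mu> M B) \<le> expected_cost S \<mu> M D) \<and>
        (\<forall>\<eta>>0. \<exists>D. routed_index S M D \<and> index_atoms D \<le> B \<and>
           expected_cost S \<mu> M D \<le> ennreal (C * (RGap S \<mu> M B + 1) + \<eta>))"
\<comment> \<open>Both witnesses are fixed before \<open>S\<close>, \<mu>, \<open>M\<close>,
  \<open>B\<close> and \<beta>; the second depends only on the evaluation bound \<kappa>.\<close>
proof (rule exI[of _ 1], intro conjI, simp, rule exI[of _ "8 + \<kappa>"], intro conjI allI impI)
  fix S :: "'u set" and \<mu> :: "'u measure" and M B \<beta>
  assume "finite S \<and> workload \<mu> \<and> atomized_family \<beta> \<kappa> (card S) \<mu> M"
  then interpret learning_problem S \<mu> M \<beta> \<kappa>
    by unfold_locales auto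
  show "ennreal (1 * RGap S \<mu> M B) \<le> expected_cost S \<mu> M D"
    if "routed_index S M D \<and> index_atoms D \<le> B" for D
    using RGap_le_expected_cost that by simp
  show "\<exists>D. routed_index S M D \<and> index_atoms D \<le> B \<and>
      expected_cost S \<mu> M D \<le> ennreal ((8 + \<kappa>) * (RGap S \<mu> M B + 1) + \<eta>)" if "0 < \<eta>" for \<eta>
    using ex_near_optimal_index assms that .
qed (use assms in auto)

end
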